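(* Consider the equality constrained retrospective approximation algorithm described in the context. Assume: (i) $\chi\subset\mathbb{R}^n$ is an open convex set containing all iterates generated by the algorithm; $f$ is continuously differentiable and bounded below on $\chi$ with $\nabla f$ Lipschitz continuous on $\chi$; $c$ is continuously differentiable, $J$ is Lipschitz continuous on $\chi$, and $J(x)$ has full row rank for all $x\in\chi$; (ii) every inner loop terminates finitely, i.e. $N_k<\infty$ for all $k\ge 0$. 1. (Finite-sum problem.) Assume there are constants $\kappa_g,\omega_1,\omega_2\ge 0$ with $\|\nabla f(x_{k,N_k})\|^2\le\kappa_g^2$ for all $k\ge0$ and $\|\nabla F(x,\xi)\|^2\le\omega_1^2\|\nabla f(x)\|^2+\omega_2^2$ for all $x\in\chi$, $\xi\in\mathcal{S}$. Let $\theta,\hat\theta,a\ge0$, $\beta\in(0,1)$, and assume the batch sizes are chosen so that for all $k\ge0$ $$\|\nabla f(x_{k,0})-g_{S_k}(x_{k,0})\|^2\le\theta^2\|T(x_{k,0},\lambda_{k-1,N_{k-1}})\|^2+a^2\beta^{2k},$$ $$\|\nabla f(x_{k,N_k})-g_{S_k}(x_{k,N_k})\|^2\le\hat\theta^2\left(\theta^2\|T(x_{k,0},\lambda_{k-1,N_{k-1}})\|^2+a^2\beta^{2k}\right).$$ If $0\le\gamma_k\le\gamma<1$ and $\epsilon_k=\omega\|\nabla f(x_{k,0})-g_{S_k}(x_{k,0})\|+\hat\omega\beta^k$ with $\omega,\hat\omega\ge0$ for all $k\ge 0$, and $a_1=\gamma+\theta(\omega+\hat\theta+\gamma)<1$,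 then for all $k\ge0$ $$\|T(x_{k,N_k},\lambda_{k,N_k})\|\le\max\{a_1+\nu,\beta\}^{k+1}\max\left\{\|T(x_{0,0},\lambda_{-1,0})\|,\tfrac{a_2}{\nu}\right\},$$ where $a_2=a(\omega+\hat\theta+\gamma)+\hat\omega$ and $\nu>0$ is such that $a_1+\nu<1$. 2. (Expectation problem.) Assume there are constants $\tilde\kappa_g,\tilde\omega_1,\tilde\omega_2\ge0$ with $\mathbb{E}[\|\nabla f(x_{k,N_k})\|^2\mid\mathcal{F}_k]\le\tilde\kappa_g^2$ for all $k\ge0$ and $\mathbb{E}[\|\nabla f(x)-\nabla F(x,\xi)\|^2\mid x]\le\tilde\omega_1^2\|\nabla f(x)\|^2+\tilde\omega_2^2$ for all $x\in\chi$. Assume further that there are $\kappa_G\ge0$ and $\kappa_\sigma>0$ such that $\mathbb{E}[G_S^2]\le\kappa_G^2/|S|$ for every set $S$ of i.i.d. samples from $\mathcal{P}$, and $\operatorname{Var}(\nabla F(x_{k,0},\xi)\mid\mathcal{F}_k)\ge\kappa_G^2\kappa_\sigma^2$ for all $k\ge0$. Let $\tilde\theta,\tilde a\ge0$, $\tilde\beta\in(0,1)$, and assume the batch sizes are chosen so that for all $k\ge0$ $$\mathbb{E}\left[\|\nabla f(x_{k,0})-g_{S_k}(x_{k,0})\|^2\mid\mathcal{F}_k\right]\le\tilde\theta^2\|T(x_{k,0},\lambda_{k-1,N_{k-1}})\|^2+\tilde a^2\tilde\beta^{2k}.$$ If $0\le\gamma_k\le\tilde\gamma<1$ and $\epsilon_k=\tilde\omega\sqrt{\operatorname{Var}(\nabla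 F(x_{k,0},\xi)\mid\mathcal{F}_k)/|S_k|}$ with $\tilde\omega\ge0$ for all $k\ge 0$, and $\tilde a_1=\tilde\gamma+\tilde\theta\left(\tilde\omega+\frac{\epsilon_G+\tilde\kappa_g}{\kappa_\sigma}+\tilde\gamma\right)<1$, then for all $k\ge0$ $$\mathbb{E}\left[\|T(x_{k,N_k},\lambda_{k,N_k})\|\right]\le\max\{\tilde a_1+\tilde\nu,\tilde\beta\}^{k+1}\max\left\{\|T(x_{0,0},\lambda_{-1,0})\|,\tfrac{\tilde a_2}{\tilde\nu}\right\},$$ where $\tilde a_2=\tilde a\left(\tilde\omega+\frac{\epsilon_G+\tilde\kappa_g}{\kappa_\sigma}+\tilde\gamma\right)$ and $\tilde\nu>0$ is such that $\tilde a_1+\tilde\nu<1$.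
   Context: Problem: $\min_{x\in\mathbb{R}^n}f(x)$ subject to $c(x)=0$, with $f:\mathbb{R}^n\to\mathbb{R}$, $c:\mathbb{R}^n\to\mathbb{R}^m$. Finite-sum problem: $f(x)=\frac{1}{|\mathcal{S}|}\sum_{\xi\in\mathcal{S}}F(x,\xi)$ for a finite dataset $\mathcal{S}$. Expectation problem: $f(x)=\mathbb{E}[F(x,\xi)]$ with $\xi\sim\mathcal{P}$ and $\nabla f(x)=\mathbb{E}[\nabla F(x,\xi)]$. $\|\cdot\|$ is the Euclidean norm. For a finite sample set $S$ ($S\subseteq\mathcal{S}$ in the finite-sum case, i.i.d. draws from $\mathcal{P}$ in the expectation case): $F_S(x)=\frac1{|S|}\sum_{\xi\in S}F(x,\xi)$, $g_S(x)=\frac1{|S|}\sum_{\xi\in S}\nabla F(x,\xi)$. $J(x)=\nabla c(x)^T$. KKT residuals: $T(x,\lambda)=\begin{bmatrix}\nabla f(x)+\nabla c(x)\lambda\\ c(x)\end{bmatrix}$, $T_S(x,\lambda)=\begin{bmatrix}g_S(x)+\nabla c(x)\lambda\\ c(x)\end{bmatrix}$. Algorithm: inputs are batch sizes $|S_k|$, parameters $\gamma_k\in[0,1)$, $\epsilon_k\ge0$, initial $x_{0,0}$ and $\lambda_{-1,0}$. At outer iteration $k=0,1,\dots$: obtain a sample set $S_k$ (in the expectation case $|S_k|$ is determined by $\mathcal{F}_k$ and the samples are i.i.d. and independent of $\mathcal{F}_k$). Set the initial dual variable $\lambda_{k,0}$ either to $\lambda_{k-1,N_{k-1}}$ or to $-(J(x_{k,0})J(x_{k,0})^T)^{-1}J(x_{k,0})g_{S_k}(x_{k,0})$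 (or to any vector with $\|T_{S_k}(x_{k,0},\lambda_{k,0})\|\le\|T_{S_k}(x_{k,0},\lambda_{k-1,N_{k-1}})\|$). Starting from $(x_{k,0},\lambda_{k,0})$ a deterministic solver applied to $\min F_{S_k}(x)$ s.t. $c(x)=0$ generates $(x_{k,j},\lambda_{k,j})$, $j=0,1,\dots$; the inner loop stops at the first index $j=N_k$ with $\|T_{S_k}(x_{k,j},\lambda_{k,j})\|\le\gamma_k\|T_{S_k}(x_{k,0},\lambda_{k,0})\|+\epsilon_k$, and $x_{k+1,0}=x_{k,N_k}$. Conventions: $N_{-1}=0$, $x_{-1,N_{-1}}=x_{0,0}$, $\lambda_{-1,N_{-1}}=\lambda_{-1,0}$. $\mathcal{F}_k$ is the $\sigma$-algebra of the initial conditions and $S_0,\dots,S_{k-1}$; $\mathbb{E}[\cdot]=\mathbb{E}[\cdot\mid\mathcal{F}_0]$. $\operatorname{Var}(\nabla F(x_{k,0},\xi)\mid\mathcal{F}_k)=\mathbb{E}[\|\nabla F(x_{k,0},\xi)-\nabla f(x_{k,0})\|^2\mid\mathcal{F}_k]$. $G_S=\max_{x\in\chi}\frac{\|\nabla f(x)-g_S(x)\|}{\epsilon_G+\|\nabla f(x)\|}$ with a fixed $\epsilon_G>0$. *)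

theory Defs
  imports "HOL-Probability.Probability"
begin

text \<open>
  \<open>gf\<close> is the gradient of \<open>f\<close>, and \<open>J x\<close> is the \<open>m \<times> n\<close> Jacobian of \<open>c\<close>, so that
  \<open>transpose (J x)\<close> is what is usually written \<open>\<nabla>c(x)\<close>. Derivatives are only required on \<open>\<X>\<close>.
\<close>

definition smooth_problem ::
  "(real ^ 'n) set \<Rightarrow> (real ^ 'n \<Rightarrow> real) \<Rightarrow> (real ^ 'n \<Rightarrow> real ^ 'n) \<Rightarrow>
   (real ^ 'n \<Rightarrow> real ^ 'm) \<Rightarrow> (real ^ 'n \<Rightarrow> real ^ 'n ^ 'm) \<Rightarrow> bool" where
  "smooth_problem \<X> f gf c J \<longleftrightarrow>
     open \<X> \<and> convex \<X> \<and>
     (\<forall>x\<in>\<X>. GDERIV f x :> gf x) \<and> continuous_on \<X> gf \<and> bdd_below (f ` \<X>) \<and>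
     (\<exists>L. L-lipschitz_on \<X> gf) \<and>
     (\<forall>x\<in>\<X>. (c has_derivative (\<lambda>h. J x *v h)) (at x)) \<and> continuous_on \<X> J \<and>
     (\<exists>L. L-lipschitz_on \<X> J) \<and>
     (\<forall>x\<in>\<X>. rank (J x) = CARD('m))"

definition finite_sum_problem ::
  "(real ^ 'n) set \<Rightarrow> 's set \<Rightarrow> (real ^ 'n \<Rightarrow> real) \<Rightarrow>
   (real ^ 'n \<Rightarrow> 's \<Rightarrow> real) \<Rightarrow> (real ^ 'n \<Rightarrow> 's \<Rightarrow> real ^ 'n) \<Rightarrow> bool" where
  "finite_sum_problem \<X> D f F gF \<longleftrightarrow>
     finite D \<and> D \<noteq> {} \<and>
     (\<forall>x. f x = (\<Sum>\<xi>\<in>D. F x \<xi>) / real (card D)) \<and>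
     (\<forall>\<xi>\<in>D. \<forall>x\<in>\<X>. GDERIV (\<lambda>y. F y \<xi>) x :> gF x \<xi>)"

text \<open>
  The joint measurability clause makes the sampled gradient at a random iterate a random variable.
\<close>

definition expectation_problem ::
  "(real ^ 'n) set \<Rightarrow> 's measure \<Rightarrow> (real ^ 'n \<Rightarrow> real) \<Rightarrow> (real ^ 'n \<Rightarrow> real ^ 'n) \<Rightarrow>
   (real ^ 'n \<Rightarrow> 's \<Rightarrow> real) \<Rightarrow> (real ^ 'n \<Rightarrow> 's \<Rightarrow> real ^ 'n) \<Rightarrow> bool" where
  "expectation_problem \<X> P f gf F gF \<longleftrightarrow>
     prob_space P \<and>
     (\<forall>x. integrable P (F x) \<and> f x = (\<integral>\<xi>. F x \<xi> \<partial>P)) \<and>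
     (\<forall>\<xi>\<in>space P. \<forall>x\<in>\<X>. GDERIV (\<lambda>y. F y \<xi>) x :> gF x \<xi>) \<and>
     (\<lambda>(x, \<xi>). gF x \<xi>) \<in> borel_measurable (restrict_space borel \<X> \<Otimes>\<^sub>M P) \<and>
     (\<forall>x\<in>\<X>. integrable P (gF x) \<and> gf x = (\<integral>\<xi>. gF x \<xi> \<partial>P))"

text \<open>
  Sample sets are finite multisets, because i.i.d. draws may coincide. A plain finite set \<open>S\<close>
  is used through \<open>mset_set S\<close>.
\<close>

definition sample_grad :: "(real ^ 'n \<Rightarrow> 's \<Rightarrow> real ^ 'n) \<Rightarrow> 's multiset \<Rightarrow> real ^ 'n \<Rightarrow> real ^ 'n" where
  "sample_grad gF S x = (1 / real (size S)) *\<^sub>R (\<Sum>\<xi>\<in>#S. gF x \<xi>)"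

text \<open>
  The first argument is either \<open>gf\<close>, giving \<open>T\<close>, or \<open>sample_grad gF S\<close>, giving \<open>T\<^sub>S\<close>.
  The norm of a pair is the Euclidean norm of the stacked vector.
\<close>

definition kkt_residual ::
  "(real ^ 'n \<Rightarrow> real ^ 'n) \<Rightarrow> (real ^ 'n \<Rightarrow> real ^ 'm) \<Rightarrow> (real ^ 'n \<Rightarrow> real ^ 'n ^ 'm) \<Rightarrow>
   real ^ 'n \<Rightarrow> real ^ 'm \<Rightarrow> (real ^ 'n) \<times> (real ^ 'm)" where
  "kkt_residual g c J x l = (g x + transpose (J x) *v l, c x)"

text \<open>
  \<open>G\<^sub>S\<close>, as an extended nonnegative supremum: on an open set the maximum need not be attained.
\<close>

definition grad_error_ratio ::
  "(real ^ 'n) set \<Rightarrow> (real ^ 'n \<Rightarrow> real ^ 'n) \<Rightarrow> (real ^ 'n \<Rightarrow> 's \<Rightarrow> real ^ 'n) \<Rightarrow> real \<Rightarrow>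
   's multiset \<Rightarrow> ennreal" where
  "grad_error_ratio \<X> gf gF \<epsilon>G S =
     (SUP x\<in>\<X>. ennreal (norm (gf x - sample_grad gF S x) / (\<epsilon>G + norm (gf x))))"

text \<open>
  \<open>outer_prev u v N k\<close> is \<open>v\<^bsub>k-1,N(k-1)\<^esub>\<close> with the convention that it is \<open>u\<close> for \<open>k = 0\<close>.
\<close>

definition outer_prev :: "'a \<Rightarrow> (nat \<Rightarrow> nat \<Rightarrow> 'a) \<Rightarrow> (nat \<Rightarrow> nat) \<Rightarrow> nat \<Rightarrow> 'a" where
  "outer_prev u v N k = (case k of 0 \<Rightarrow> u | Suc i \<Rightarrow> v i (N i))"

definition inner_stop ::
  "(real ^ 'n \<Rightarrow> 's \<Rightarrow> real ^ 'n) \<Rightarrow> (real ^ 'n \<Rightarrow> real ^ 'm) \<Rightarrow> (real ^ 'n \<Rightarrow> real ^ 'n ^ 'm) \<Rightarrow>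
   (nat \<Rightarrow> 's multiset) \<Rightarrow> (nat \<Rightarrow> real) \<Rightarrow> (nat \<Rightarrow> real) \<Rightarrow>
   (nat \<Rightarrow> nat \<Rightarrow> real ^ 'n) \<Rightarrow> (nat \<Rightarrow> nat \<Rightarrow> real ^ 'm) \<Rightarrow> nat \<Rightarrow> nat \<Rightarrow> bool" where
  "inner_stop gF c J S \<gamma> \<epsilon> x lam k j \<longleftrightarrow>
     norm (kkt_residual (sample_grad gF (S k)) c J (x k j) (lam k j))
       \<le> \<gamma> k * norm (kkt_residual (sample_grad gF (S k)) c J (x k 0) (lam k 0)) + \<epsilon> k"

text \<open>
  The deterministic solver is an arbitrary function producing, from the sample set (which
  determines \<open>F\<^sub>S\<close>) and the starting pair, the whole sequence of inner iterates; it may differ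
  between outer iterations. Instantiating its clause at \<open>j = 0\<close> says that the sequence starts at
  the starting pair.
\<close>

definition retro_run ::
  "(real ^ 'n \<Rightarrow> 's \<Rightarrow> real ^ 'n) \<Rightarrow> (real ^ 'n \<Rightarrow> real ^ 'm) \<Rightarrow> (real ^ 'n \<Rightarrow> real ^ 'n ^ 'm) \<Rightarrow>
   (nat \<Rightarrow> 's multiset \<Rightarrow> (real ^ 'n) \<times> (real ^ 'm) \<Rightarrow> nat \<Rightarrow> (real ^ 'n) \<times> (real ^ 'm)) \<Rightarrow>
   (nat \<Rightarrow> 's multiset) \<Rightarrow> (nat \<Rightarrow> real) \<Rightarrow> (nat \<Rightarrow> real) \<Rightarrow> real ^ 'n \<Rightarrow> real ^ 'm \<Rightarrow>
   (nat \<Rightarrow> nat \<Rightarrow> real ^ 'n) \<Rightarrow> (nat \<Rightarrow> nat \<Rightarrow> real ^ 'm) \<Rightarrow> (nat \<Rightarrow> nat) \<Rightarrow> bool" where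
  "retro_run gF c J solver S \<gamma> \<epsilon> x0 l0 x lam N \<longleftrightarrow>
     (\<forall>k. 0 \<le> \<gamma> k \<and> \<gamma> k < 1 \<and> 0 \<le> \<epsilon> k) \<and>
     (\<forall>k. x k 0 = outer_prev x0 x N k) \<and>
     (\<forall>k. lam k 0 = outer_prev l0 lam N k \<or>
          lam k 0 = - (matrix_inv (J (x k 0) ** transpose (J (x k 0))) *v
                         (J (x k 0) *v sample_grad gF (S k) (x k 0))) \<or>
          norm (kkt_residual (sample_grad gF (S k)) c J (x k 0) (lam k 0))
            \<le> norm (kkt_residual (sample_grad gF (S k)) c J (x k 0) (outer_prev l0 lam N k))) \<and>
     (\<forall>k j. (x k j, lam k j) = solver k (S k) (x k 0, lam k 0) j) \<and>
     (\<forall>k. N k = (LEAST j. inner_stop gF c J S \<gamma> \<epsilon> x lam k j))"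

definition draws :: "nat \<Rightarrow> (nat \<Rightarrow> 's) \<Rightarrow> 's multiset" where
  "draws n s = {# s i. i \<in># mset_set {..<n} #}"

text \<open>
  The sample set of outer iteration \<open>k\<close> consists of \<open>\<xi> k i\<close> for \<open>i < n k\<close>. The \<open>\<sigma>\<close>-algebra
  \<open>\<F>\<^sub>k\<close> is generated by the initial conditions and the finite sequences \<open>S\<^sub>0, \<dots>, S\<^bsub>k-1\<^esub>\<close>, that
  is, by their lengths and by those of their entries that are actually drawn.
\<close>

definition history ::
  "'w measure \<Rightarrow> 's measure \<Rightarrow> ('w \<Rightarrow> real ^ 'n) \<Rightarrow> ('w \<Rightarrow> real ^ 'm) \<Rightarrow>
   (nat \<Rightarrow> 'w \<Rightarrow> nat) \<Rightarrow> (nat \<Rightarrow> nat \<Rightarrow> 'w \<Rightarrow> 's) \<Rightarrow> nat \<Rightarrow> 'w measure" where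
  "history M P x0 l0 n \<xi> k = sigma (space M)
     ({x0 -` B \<inter> space M | B. B \<in> sets borel} \<union>
      {l0 -` B \<inter> space M | B. B \<in> sets borel} \<union>
      {{\<omega> \<in> space M. n i \<omega> = q} | i q. i < k} \<union>
      {{\<omega> \<in> space M. j < n i \<omega> \<and> \<xi> i j \<omega> \<in> B} | i j B. i < k \<and> B \<in> sets P})"

text \<open>
  The last clause says that, conditionally on \<open>\<F>\<^sub>k\<close> and hence on the \<open>\<F>\<^sub>k\<close>-measurable size \<open>n k\<close>,
  the \<open>n k\<close> samples are i.i.d. with law \<open>P\<close> and independent of \<open>\<F>\<^sub>k\<close>. It is stated for the
  samples actually drawn only; the values \<open>\<xi> k i\<close> with \<open>i \<ge> n k\<close> carry no meaning.
\<close>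

definition random_sampling ::
  "'w measure \<Rightarrow> 's measure \<Rightarrow> ('w \<Rightarrow> real ^ 'n) \<Rightarrow> ('w \<Rightarrow> real ^ 'm) \<Rightarrow>
   (nat \<Rightarrow> 'w \<Rightarrow> nat) \<Rightarrow> (nat \<Rightarrow> nat \<Rightarrow> 'w \<Rightarrow> 's) \<Rightarrow> bool" where
  "random_sampling M P x0 l0 n \<xi> \<longleftrightarrow>
     prob_space M \<and> x0 \<in> borel_measurable M \<and> l0 \<in> borel_measurable M \<and>
     (\<forall>k i. \<xi> k i \<in> measurable M P) \<and>
     (\<forall>k. \<forall>\<omega>\<in>space M. 1 \<le> n k \<omega>) \<and>
     (\<forall>k. n k \<in> measurable (history M P x0 l0 n \<xi> k) (count_space UNIV)) \<and>
     (\<forall>k q. \<forall>A\<in>sets (history M P x0 l0 n \<xi> k). \<forall>B. (\<forall>i<q. B i \<in> sets P) \<longrightarrow>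
        measure M {\<omega> \<in> A. n k \<omega> = q \<and> (\<forall>i<q. \<xi> k i \<omega> \<in> B i)}
          = measure M {\<omega> \<in> A. n k \<omega> = q} * (\<Prod>i<q. measure P (B i)))"

text \<open>
  Measurability of the ingredients of the algorithm: the solver is a measurable function of the
  samples and the starting pair, and the random choices of \<open>\<epsilon>\<^sub>k\<close> and \<open>\<lambda>\<^bsub>k,0\<^esub>\<close> depend only on
  the information available when they are made. Measurability of the iterates is not assumed.
\<close>

definition measurable_choices ::
  "'w measure \<Rightarrow> 's measure \<Rightarrow> ('w \<Rightarrow> real ^ 'n) \<Rightarrow> ('w \<Rightarrow> real ^ 'm) \<Rightarrow>
   (nat \<Rightarrow> 'w \<Rightarrow> nat) \<Rightarrow> (nat \<Rightarrow> nat \<Rightarrow> 'w \<Rightarrow> 's) \<Rightarrow>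
   (nat \<Rightarrow> 's multiset \<Rightarrow> (real ^ 'n) \<times> (real ^ 'm) \<Rightarrow> nat \<Rightarrow> (real ^ 'n) \<times> (real ^ 'm)) \<Rightarrow>
   (nat \<Rightarrow> 'w \<Rightarrow> real) \<Rightarrow> (nat \<Rightarrow> nat \<Rightarrow> 'w \<Rightarrow> real ^ 'm) \<Rightarrow> bool" where
  "measurable_choices M P x0 l0 n \<xi> solver \<epsilon> lam \<longleftrightarrow>
     (\<forall>k q j. (\<lambda>(s, z). solver k (draws q s) z j)
        \<in> borel_measurable ((\<Pi>\<^sub>M i\<in>{..<q}. P) \<Otimes>\<^sub>M borel)) \<and>
     (\<forall>k. \<epsilon> k \<in> borel_measurable (history M P x0 l0 n \<xi> k)) \<and>
     (\<forall>k. lam k 0 \<in> borel_measurable (history M P x0 l0 n \<xi> (Suc k)))"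

text \<open>
  \<open>Var(\<nabla>F(X,\<xi>) | H)\<close> for a sample \<open>\<xi>\<close> with law \<open>P\<close> independent of \<open>H\<close>. Every sample set is
  nonempty, so \<open>\<xi> k 0\<close> is always a genuine sample and can serve as \<open>\<xi>\<close> for \<open>H = \<F>\<^sub>k\<close>. The value
  lives in \<open>ennreal\<close>, so that an infinite variance is not silently turned into \<open>0\<close>.
\<close>

definition cond_grad_var ::
  "'w measure \<Rightarrow> 'w measure \<Rightarrow> (real ^ 'n \<Rightarrow> real ^ 'n) \<Rightarrow> (real ^ 'n \<Rightarrow> 's \<Rightarrow> real ^ 'n) \<Rightarrow>
   ('w \<Rightarrow> real ^ 'n) \<Rightarrow> ('w \<Rightarrow> 's) \<Rightarrow> 'w \<Rightarrow> ennreal" where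
  "cond_grad_var M H gf gF X \<xi> =
     nn_cond_exp M H (\<lambda>\<omega>. ennreal ((norm (gF (X \<omega>) (\<xi> \<omega>) - gf (X \<omega>)))\<^sup>2))"

end

theory Submission
  imports Defs
begin

text \<open>
  Replacing \<open>T\<^sub>S\<close> by \<open>T\<close> costs at most the gradient sampling error, so the stopping test and the
  choice of \<open>\<lambda>\<^bsub>k,0\<^esub>\<close> bound the residual at the end of an inner loop by \<open>\<gamma>\<^sub>k\<close> times the previous
  residual, plus \<open>\<epsilon>\<^sub>k\<close>, plus the sampling errors at the two ends of the loop. All of these are at
  most multiples of \<open>\<theta> \<parallel>T\<parallel> + a \<beta>\<^sup>k\<close>, which yields a recursion
  \<open>z\<^bsub>k+1\<^esub> \<le> a\<^sub>1 z\<^sub>k + a\<^sub>2 \<beta>\<^sup>k\<close>. In the expectation case the same recursion holds for conditional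
  expectations: the mean squared error at the start of the loop is exactly \<open>Var / n\<^sub>k\<close>, while the
  final iterate depends on the sample, so that the error there is controlled uniformly by
  \<open>G\<^sub>S (\<epsilon>\<^sub>G + \<parallel>\<nabla>f\<parallel>)\<close> and the Cauchy--Schwarz inequality; the lower bound on the variance turns
  \<open>\<kappa>\<^sub>G / \<surd>n\<^sub>k\<close> into a multiple of \<open>(Var / n\<^sub>k)\<^bsup>1/2\<^esup>\<close>.
\<close>


section \<open>The outer iteration for a fixed sequence of sample sets\<close>

text \<open>Two features of the setting shape the rest. The batch size is random: a batch is a point
  of a product space that changes with \<open>n k\<close>, and values beyond \<open>n k\<close> are
  meaningless. Statements about batches are therefore proved on events where \<open>n k\<close> has
  a fixed value and then glued over the countably many values. Measurability of the iterates is a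
  result rather than an assumption; it follows by induction over the outer iterations and has to
  pass through the random stopping index \<open>N k\<close>.\<close>

lemma norm_kkt_residual_perturb:
  "norm (kkt_residual g c J x l) \<le> norm (kkt_residual h c J x l) + norm (g x - h x)"
proof -
  have "kkt_residual g c J x l = kkt_residual h c J x l + (g x - h x, 0)"
    by (simp add: kkt_residual_def)
  then show ?thesis
    using norm_triangle_ineq[of "kkt_residual h c J x l" "(g x - h x, 0)"] by (simp add: norm_Pair)
qed

text \<open>The closed formula is the least-squares multiplier: its residual \<open>r\<close> lies
  in the kernel of \<open>A\<close>, hence is orthogonal to the range of the transpose, and changing
  the multiplier only adds a vector \<open>d\<close> from that range. This reduces the second rule
  for the initial dual variable to the third.\<close>

lemma norm_kkt_residual_least_squares:
  fixes J :: "real ^ 'n \<Rightarrow> real ^ 'n ^ 'm"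
  assumes "rank (J x) = CARD('m)"
  shows "norm (kkt_residual g c J x (- (matrix_inv (J x ** transpose (J x)) *v (J x *v g x))))
           \<le> norm (kkt_residual g c J x l)"
proof -
  define A where "A = J x"
  define B where "B = A ** transpose A"
  define l' where "l' = - (matrix_inv B *v (A *v g x))"
  define r where "r = g x + transpose A *v l'"
  define d where "d = transpose A *v (l - l')"
  have "inj ((*v) (transpose A))"
    using assms by (simp add: A_def rank_transpose flip: full_rank_injective)
  then have inj: "y = 0" if "transpose A *v y = 0" for y
    using that injD[OF \<open>inj _\<close>, of y 0] by simp
  have "y = 0" if "B *v y = 0" for y
  proof -
    \<comment> \<open>Here \<open>y v* A\<close> is the simp normal form of
      \<open>transpose A *v y\<close>. Its squared norm is the inner product of \<open>y\<close> and
      \<open>B *v y\<close>, so the kernel of \<open>B\<close> is trivial once the transpose is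
      injective.\<close>
    have "B *v y = A *v (y v* A)"
      by (simp add: B_def flip: matrix_vector_mul_assoc)
    then have "inner (y v* A) (y v* A) = inner y (B *v y)"
      by (simp add: dot_lmul_matrix)
    then show ?thesis
      using that inj by simp
  qed
  then have "invertible B"
    unfolding invertible_left_inverse matrix_left_invertible_ker by simp
  then have "B ** matrix_inv B = mat 1"
    unfolding invertible_def matrix_inv_def by (rule someI2_ex) simp
  then have "B *v l' = - (A *v g x)"
    unfolding l'_def
    by (simp add: linear_neg[OF matrix_vector_mul_linear] matrix_vector_mul_assoc matrix_mul_assoc)
  then have Ar: "A *v r = 0"
    by (simp add: r_def B_def matrix_vector_right_distrib matrix_vector_mul_assoc
        del: transpose_matrix_vector)
  have "inner r d = 0"
    unfolding d_def using Ar
    by (simp add: inner_commute[of r] dot_lmul_matrix)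
  then have "(norm (r + d))\<^sup>2 = (norm r)\<^sup>2 + (norm d)\<^sup>2"
    by (simp add: norm_add_Pythagorean orthogonal_def)
  moreover have "g x + transpose A *v l = r + d"
    by (simp add: r_def d_def matrix_vector_mult_diff_distrib)
  ultimately show ?thesis
    unfolding kkt_residual_def norm_Pair fst_conv snd_conv A_def[symmetric] B_def[symmetric]
      l'_def[symmetric] r_def[symmetric]
    by simp
qed

text \<open>This is the origin of \<open>\<nu>\<close> and of \<open>a\<^sub>2 / \<nu>\<close>.
  Since \<open>a\<^sub>2 \<le> \<nu> * C\<close> and the rate dominates \<open>\<beta>\<close>, the
  forcing term is at most \<open>\<nu> * C\<close> times the \<open>k\<close>-th power of the rate;
  together with the factor \<open>a\<^sub>1\<close> this costs exactly
  \<open>a\<^sub>1 + \<nu>\<close>, so the geometric bound reproduces itself.\<close>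

lemma geometric_recursion_step:
  fixes a\<^sub>1 a\<^sub>2 \<nu> \<beta> z C :: real
  assumes "0 \<le> a\<^sub>1" "0 < \<nu>" "0 \<le> \<beta>" "a\<^sub>2 / \<nu> \<le> C" "0 \<le> C"
    and z: "z \<le> max (a\<^sub>1 + \<nu>) \<beta> ^ k * C"
  shows "a\<^sub>1 * z + a\<^sub>2 * \<beta> ^ k \<le> max (a\<^sub>1 + \<nu>) \<beta> ^ Suc k * C"
proof -
  let ?\<rho> = "max (a\<^sub>1 + \<nu>) \<beta>"
  have "a\<^sub>2 \<le> \<nu> * C"
    using assms by (simp add: divide_le_eq mult.commute)
  then have "a\<^sub>2 * \<beta> ^ k \<le> \<nu> * C * ?\<rho> ^ k"
    using assms by (intro mult_mono power_mono) auto
  moreover have "a\<^sub>1 * z \<le> a\<^sub>1 * (?\<rho> ^ k * C)"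
    using assms by (intro mult_left_mono)
  ultimately have "a\<^sub>1 * z + a\<^sub>2 * \<beta> ^ k \<le> (a\<^sub>1 + \<nu>) * (?\<rho> ^ k * C)"
    by (simp add: algebra_simps)
  also have "\<dots> \<le> ?\<rho> * (?\<rho> ^ k * C)"
    using assms by (intro mult_right_mono) auto
  finally show ?thesis
    by (simp add: mult_ac)
qed

text \<open>The chain passes from the true residual to the sampled one at the end of the loop,
  through the stopping test and the comparison of dual starting points, and back to the true
  residual at the start. Each change of residual costs one sampling error; only the one at the start
  is multiplied by \<open>\<gamma> k\<close>.\<close>

lemma outer_loop_bound:
  fixes J :: "real ^ 'n \<Rightarrow> real ^ 'n ^ 'm"
  assumes run: "retro_run gF c J solver S \<gamma> \<epsilon> x0 l0 x lam N"
    and stop: "\<exists>j. inner_stop gF c J S \<gamma> \<epsilon> x lam k j"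
    and rank: "rank (J (x k 0)) = CARD('m)"
  shows "norm (kkt_residual gf c J (x k (N k)) (lam k (N k)))
    \<le> \<gamma> k * (norm (kkt_residual gf c J (x k 0) (outer_prev l0 lam N k))
              + norm (gf (x k 0) - sample_grad gF (S k) (x k 0)))
      + \<epsilon> k + norm (gf (x k (N k)) - sample_grad gF (S k) (x k (N k)))"
proof -
  let ?gS = "sample_grad gF (S k)" and ?\<mu> = "outer_prev l0 lam N k"
  \<comment> \<open>\<open>N k\<close> is a \<open>LEAST\<close>, which satisfies its predicate only
    if some index does; this is where finite termination enters.\<close>
  have "inner_stop gF c J S \<gamma> \<epsilon> x lam k (N k)"
    using run LeastI_ex[OF stop] by (simp add: retro_run_def)
  then have end_le: "norm (kkt_residual ?gS c J (x k (N k)) (lam k (N k)))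
      \<le> \<gamma> k * norm (kkt_residual ?gS c J (x k 0) (lam k 0)) + \<epsilon> k"
    by (simp add: inner_stop_def)
  have "lam k 0 = ?\<mu> \<or> lam k 0 = - (matrix_inv (J (x k 0) ** transpose (J (x k 0))) *v
                         (J (x k 0) *v ?gS (x k 0))) \<or>
      norm (kkt_residual ?gS c J (x k 0) (lam k 0)) \<le> norm (kkt_residual ?gS c J (x k 0) ?\<mu>)"
    using run unfolding retro_run_def by blast
  then have "norm (kkt_residual ?gS c J (x k 0) (lam k 0)) \<le> norm (kkt_residual ?gS c J (x k 0) ?\<mu>)"
    using norm_kkt_residual_least_squares[where J = J and x = "x k 0", OF rank, of ?gS c ?\<mu>] by auto
  also have "\<dots> \<le> norm (kkt_residual gf c J (x k 0) ?\<mu>) + norm (gf (x k 0) - ?gS (x k 0))"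
    by (metis norm_kkt_residual_perturb norm_minus_commute)
  finally have "\<gamma> k * norm (kkt_residual ?gS c J (x k 0) (lam k 0))
      \<le> \<gamma> k * (norm (kkt_residual gf c J (x k 0) ?\<mu>) + norm (gf (x k 0) - ?gS (x k 0)))"
    using run by (intro mult_left_mono) (auto simp: retro_run_def)
  with end_le norm_kkt_residual_perturb[of gf c J "x k (N k)" "lam k (N k)" ?gS]
  show ?thesis by linarith
qed

lemma sqrt_sum_squares_geometric_le:
  fixes \<theta> t a \<beta> :: real
  assumes "0 \<le> \<theta>" "0 \<le> t" "0 \<le> a" "0 \<le> \<beta>"
  shows "sqrt (\<theta>\<^sup>2 * t\<^sup>2 + a\<^sup>2 * \<beta> ^ (2 * k)) \<le> \<theta> * t + a * \<beta> ^ k"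
proof -
  have "\<theta>\<^sup>2 * t\<^sup>2 + a\<^sup>2 * \<beta> ^ (2 * k) = (\<theta> * t)\<^sup>2 + (a * \<beta> ^ k)\<^sup>2"
    by (simp add: power_mult_distrib power_mult mult.commute[of 2])
  then show ?thesis
    using sqrt_sum_squares_le_sum[of "\<theta> * t" "a * \<beta> ^ k"] assms by simp
qed

text \<open>Arithmetic shared by both problems. In the finite-sum case \<open>e\<close> and
  \<open>e'\<close> are the actual sampling errors, \<open>\<phi>\<close> is the constant relating
  them and \<open>d\<close> is the extra term in the tolerance. In the expectation case
  \<open>e\<close> and \<open>e'\<close> are bounds on their conditional means and
  \<open>d = 0\<close>.\<close>

lemma outer_loop_recursion:
  fixes \<gamma>k :: real
  assumes "0 \<le> \<gamma>k" "\<gamma>k \<le> \<gamma>'" "0 \<le> t" "0 \<le> e"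
    and t': "t' \<le> \<gamma>k * (t + e) + \<epsilon> + e'"
    and e: "e \<le> \<theta> * t + b" and \<epsilon>: "\<epsilon> \<le> \<omega> * (\<theta> * t + b) + d" and e': "e' \<le> \<phi> * (\<theta> * t + b)"
  shows "t' \<le> (\<gamma>' + \<theta> * (\<omega> + \<phi> + \<gamma>')) * t + (b * (\<omega> + \<phi> + \<gamma>') + d)"
proof -
  have "\<gamma>k * (t + e) \<le> \<gamma>' * (t + (\<theta> * t + b))"
    using assms by (intro mult_mono) auto
  with t' \<epsilon> e' show ?thesis by (simp add: algebra_simps)
qed

lemma deterministic_bound:
  fixes J :: "real ^ 'n \<Rightarrow> real ^ 'n ^ 'm"
  assumes problem: "smooth_problem \<X> f gf c J"
    and run: "retro_run gF c J solver S \<gamma> \<epsilon> x0 l0 x lam N"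
    and stop: "\<And>k. \<exists>j. inner_stop gF c J S \<gamma> \<epsilon> x lam k j"
    and dom: "\<And>k. x k 0 \<in> \<X>"
    and nonneg: "0 \<le> \<theta>" "0 \<le> \<theta>'" "0 \<le> a" "0 < \<beta>" "0 \<le> \<omega>" "0 \<le> \<omega>'" "0 < \<nu>"
    and start: "\<And>k. (norm (gf (x k 0) - sample_grad gF (S k) (x k 0)))\<^sup>2
        \<le> \<theta>\<^sup>2 * (norm (kkt_residual gf c J (x k 0) (outer_prev l0 lam N k)))\<^sup>2 + a\<^sup>2 * \<beta> ^ (2 * k)"
    and final: "\<And>k. (norm (gf (x k (N k)) - sample_grad gF (S k) (x k (N k))))\<^sup>2
        \<le> \<theta>'\<^sup>2 * (\<theta>\<^sup>2 * (norm (kkt_residual gf c J (x k 0) (outer_prev l0 lam N k)))\<^sup>2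
                  + a\<^sup>2 * \<beta> ^ (2 * k))"
    and \<gamma>: "\<And>k. 0 \<le> \<gamma> k" "\<And>k. \<gamma> k \<le> \<gamma>'"
    and \<epsilon>: "\<And>k. \<epsilon> k = \<omega> * norm (gf (x k 0) - sample_grad gF (S k) (x k 0)) + \<omega>' * \<beta> ^ k"
    and a\<^sub>1: "a\<^sub>1 = \<gamma>' + \<theta> * (\<omega> + \<theta>' + \<gamma>')" and a\<^sub>2: "a\<^sub>2 = a * (\<omega> + \<theta>' + \<gamma>') + \<omega>'"
  shows "norm (kkt_residual gf c J (x k (N k)) (lam k (N k)))
    \<le> max (a\<^sub>1 + \<nu>) \<beta> ^ Suc k * max (norm (kkt_residual gf c J x0 l0)) (a\<^sub>2 / \<nu>)"
proof -
  define t where "t k = norm (kkt_residual gf c J (x k 0) (outer_prev l0 lam N k))" for k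
  define C where "C = max (norm (kkt_residual gf c J x0 l0)) (a\<^sub>2 / \<nu>)"
  have "0 \<le> \<gamma>'"
    using \<gamma>[of 0] by simp
  have x0: "x k 0 = outer_prev x0 x N k" for k
    using run by (simp add: retro_run_def)
  \<comment> \<open>The end of one loop is the start of the next, for the primal and the dual
    variable, so the bound for \<open>t\<close> at \<open>Suc k\<close> is the claimed bound at the
    end of loop \<open>k\<close>. This explains the exponent \<open>Suc k\<close>.\<close>
  have t_Suc: "t (Suc k) = norm (kkt_residual gf c J (x k (N k)) (lam k (N k)))" for k
    by (simp add: t_def x0[of "Suc k"] outer_prev_def)
  have step: "t (Suc k) \<le> a\<^sub>1 * t k + a\<^sub>2 * \<beta> ^ k" for k
  proof -
    define s where "s = sqrt (\<theta>\<^sup>2 * (t k)\<^sup>2 + a\<^sup>2 * \<beta> ^ (2 * k))"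
    have s: "s \<le> \<theta> * t k + a * \<beta> ^ k"
      unfolding s_def using nonneg by (intro sqrt_sum_squares_geometric_le) (auto simp: t_def)
    let ?e = "norm (gf (x k 0) - sample_grad gF (S k) (x k 0))"
    let ?e' = "norm (gf (x k (N k)) - sample_grad gF (S k) (x k (N k)))"
    have e: "?e \<le> s"
      unfolding s_def using start[of k] by (intro real_le_rsqrt) (simp add: t_def)
    have "?e' \<le> sqrt (\<theta>'\<^sup>2 * (\<theta>\<^sup>2 * (t k)\<^sup>2 + a\<^sup>2 * \<beta> ^ (2 * k)))"
      using final[of k] by (intro real_le_rsqrt) (simp add: t_def)
    then have "?e' \<le> \<theta>' * s"
      using nonneg by (simp add: real_sqrt_mult s_def)
    also have "\<dots> \<le> \<theta>' * (\<theta> * t k + a * \<beta> ^ k)"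
      using s nonneg by (intro mult_left_mono)
    finally have e': "?e' \<le> \<theta>' * (\<theta> * t k + a * \<beta> ^ k)" .
    have "rank (J (x k 0)) = CARD('m)"
      using problem dom by (auto simp: smooth_problem_def)
    from outer_loop_bound[OF run stop this, of gf]
    have t': "t (Suc k) \<le> \<gamma> k * (t k + ?e) + \<epsilon> k + ?e'"
      by (simp add: t_Suc) (simp add: t_def)
    have "\<epsilon> k \<le> \<omega> * (\<theta> * t k + a * \<beta> ^ k) + \<omega>' * \<beta> ^ k"
      unfolding \<epsilon> using e s nonneg by (intro add_right_mono mult_left_mono) auto
    from outer_loop_recursion[OF \<gamma>(1) \<gamma>(2) _ _ t' _ this e'] e s
    have "t (Suc k) \<le> (\<gamma>' + \<theta> * (\<omega> + \<theta>' + \<gamma>')) * t k + (a * \<beta> ^ k * (\<omega> + \<theta>' + \<gamma>') + \<omega>' * \<beta> ^ k)"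
      by (simp add: t_def)
    then show ?thesis
      unfolding a\<^sub>1 a\<^sub>2 by (simp add: algebra_simps)
  qed
  have "t k \<le> max (a\<^sub>1 + \<nu>) \<beta> ^ k * C" for k
  proof (induction k)
    case 0
    then show ?case
      by (simp add: t_def x0 outer_prev_def C_def)
  next
    case (Suc k)
    have "a\<^sub>1 * t k + a\<^sub>2 * \<beta> ^ k \<le> max (a\<^sub>1 + \<nu>) \<beta> ^ Suc k * C"
      using Suc nonneg \<open>0 \<le> \<gamma>'\<close>
      by (intro geometric_recursion_step) (auto simp: a\<^sub>1 C_def le_max_iff_disj)
    with step[of k] show ?case by linarith
  qed
  then show ?thesis
    unfolding t_Suc[symmetric] C_def .
qed

section \<open>Conditional expectations and sums of i.i.d. vectors\<close>

text \<open>For finite values this is the nonnegativity of \<open>(w * r - s)\<^sup>2 / w\<close>. A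
  free weight is kept because it will be chosen pointwise as a measurable function.\<close>

lemma ennreal_weighted_am_gm:
  fixes a b :: ennreal and w :: real
  assumes "0 < w"
  shows "2 * (a * b) \<le> ennreal w * a\<^sup>2 + ennreal (1 / w) * b\<^sup>2"
proof (cases "a = \<top> \<or> b = \<top>")
  case True
  then show ?thesis
    using assms by (auto simp: ennreal_mult_eq_top_iff power2_eq_square ennreal_top_mult ennreal_mult_top)
next
  case False
  then obtain r s where r: "a = ennreal r" "0 \<le> r" and s: "b = ennreal s" "0 \<le> s"
    by (metis ennreal_cases)
  have "0 \<le> (w * r - s)\<^sup>2 / w"
    using assms by simp
  also have "\<dots> = w * r\<^sup>2 + 1 / w * s\<^sup>2 - 2 * (r * s)"
    using assms by (simp add: field_simps power2_eq_square)
  finally have "ennreal (2 * (r * s)) \<le> ennreal (w * r\<^sup>2 + 1 / w * s\<^sup>2)"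
    by (intro ennreal_leI) simp
  moreover have "ennreal (1 / w) * ennreal (s\<^sup>2) = ennreal (s\<^sup>2 / w)"
    using assms by (simp flip: ennreal_mult)
  ultimately show ?thesis
    using assms r s by (simp add: ennreal_mult ennreal_plus ennreal_power flip: ennreal_numeral)
qed

text \<open>Weighted AM-GM with an \<open>F\<close>-measurable weight, which can be pulled out of
  the conditional expectation. The weight \<open>v / u\<close> would give \<open>u * v\<close> at
  once but may be undefined; shifting \<open>u\<close> and \<open>v\<close> by a small positive
  constant costs a term that vanishes along a countable sequence of shifts.\<close>

lemma (in sigma_finite_subalgebra) nn_cond_exp_Cauchy_Schwarz:
  fixes f g :: "'a \<Rightarrow> ennreal" and u v :: "'a \<Rightarrow> real"
  assumes [measurable]: "f \<in> borel_measurable M" "g \<in> borel_measurable M"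
      "u \<in> borel_measurable F" "v \<in> borel_measurable F"
    and nonneg: "\<And>x. 0 \<le> u x" "\<And>x. 0 \<le> v x"
    and f: "AE x in M. nn_cond_exp M F (\<lambda>x. (f x)\<^sup>2) x \<le> ennreal ((u x)\<^sup>2)"
    and g: "AE x in M. nn_cond_exp M F (\<lambda>x. (g x)\<^sup>2) x \<le> ennreal ((v x)\<^sup>2)"
  shows "AE x in M. nn_cond_exp M F (\<lambda>x. f x * g x) x \<le> ennreal (u x * v x)"
proof -
  have [measurable]: "u \<in> borel_measurable M" "v \<in> borel_measurable M"
    by (auto intro: measurable_from_subalg[OF subalg])
  have "AE x in M. \<forall>m. nn_cond_exp M F (\<lambda>x. f x * g x) x
      \<le> ennreal (u x * v x + (u x + v x) / 2 * inverse (real (Suc m)))"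
    unfolding AE_all_countable
  proof
    fix m
    define d where "d = inverse (real (Suc m))"
    have "0 < d"
      by (simp add: d_def)
    \<comment> \<open>With this weight \<open>w * u\<^sup>2\<close> is at most
      \<open>u * (v + d)\<close> and \<open>v\<^sup>2 / w\<close> at most
      \<open>v * (u + d)\<close>; half their sum is the target.\<close>
    define w where "w x = (v x + d) / (u x + d)" for x
    have pos: "0 < u x + d" "0 < v x + d" "0 < w x" for x
      using \<open>0 < d\<close> nonneg[of x] by (auto simp: w_def add_nonneg_pos)
    have [measurable]: "w \<in> borel_measurable F" "w \<in> borel_measurable M"
        unfolding w_def by measurable
    let ?E = "nn_cond_exp M F"
    have "AE x in M. ?E (\<lambda>x. 2 * (f x * g x)) x
        \<le> ?E (\<lambda>x. ennreal (w x) * (f x)\<^sup>2 + ennreal (1 / w x) * (g x)\<^sup>2) x"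
      by (intro nn_cond_exp_mono AE_I2 ennreal_weighted_am_gm pos) auto
    moreover have "AE x in M. 2 * ?E (\<lambda>x. f x * g x) x = ?E (\<lambda>x. 2 * (f x * g x)) x"
      by (rule nn_cond_exp_prod) auto
    moreover have "AE x in M. ?E (\<lambda>x. ennreal (w x) * (f x)\<^sup>2) x + ?E (\<lambda>x. ennreal (1 / w x) * (g x)\<^sup>2) x
        = ?E (\<lambda>x. ennreal (w x) * (f x)\<^sup>2 + ennreal (1 / w x) * (g x)\<^sup>2) x"
      by (rule nn_cond_exp_sum) auto
    moreover have "AE x in M. ennreal (w x) * ?E (\<lambda>x. (f x)\<^sup>2) x = ?E (\<lambda>x. ennreal (w x) * (f x)\<^sup>2) x"
      by (rule nn_cond_exp_prod) auto
    moreover have "AE x in M. ennreal (1 / w x) * ?E (\<lambda>x. (g x)\<^sup>2) x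
        = ?E (\<lambda>x. ennreal (1 / w x) * (g x)\<^sup>2) x"
      by (rule nn_cond_exp_prod) auto
    ultimately show "AE x in M. ?E (\<lambda>x. f x * g x) x
      \<le> ennreal (u x * v x + (u x + v x) / 2 * inverse (real (Suc m)))"
      using f g unfolding d_def[symmetric]
    proof eventually_elim
      case (elim x)
      have "2 * ?E (\<lambda>x. f x * g x) x \<le> ennreal (w x) * ?E (\<lambda>x. (f x)\<^sup>2) x + ennreal (1 / w x) * ?E (\<lambda>x. (g x)\<^sup>2) x"
        using elim by simp
      also have "\<dots> \<le> ennreal (w x) * ennreal ((u x)\<^sup>2) + ennreal (1 / w x) * ennreal ((v x)\<^sup>2)"
        using elim by (intro add_mono mult_left_mono) auto
      also have "\<dots> = ennreal (w x * (u x)\<^sup>2 + 1 / w x * (v x)\<^sup>2)"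
        using pos[of x] by (simp flip: ennreal_mult ennreal_plus)
      also have "\<dots> \<le> ennreal (2 * (u x * v x + (u x + v x) / 2 * d))"
      proof (intro ennreal_leI)
        have "(u x)\<^sup>2 \<le> u x * (u x + d)" "(v x)\<^sup>2 \<le> v x * (v x + d)"
          using \<open>0 < d\<close> nonneg[of x] by (auto simp: power2_eq_square intro!: mult_left_mono)
        then have "w x * (u x)\<^sup>2 \<le> w x * (u x * (u x + d))" "1 / w x * (v x)\<^sup>2 \<le> 1 / w x * (v x * (v x + d))"
          using pos(3)[of x] by (auto intro!: mult_left_mono divide_right_mono)
        moreover have "w x * (u x * (u x + d)) = (v x + d) * u x" "1 / w x * (v x * (v x + d)) = (u x + d) * v x"
          using pos(1,2)[of x] by (auto simp: w_def)
        moreover have "(v x + d) * u x + (u x + d) * v x = 2 * (u x * v x + (u x + v x) / 2 * d)"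
          by (simp add: field_simps)
        ultimately show "w x * (u x)\<^sup>2 + 1 / w x * (v x)\<^sup>2 \<le> 2 * (u x * v x + (u x + v x) / 2 * d)"
          by linarith
      qed
      also have "\<dots> = 2 * ennreal (u x * v x + (u x + v x) / 2 * d)"
        using nonneg[of x] \<open>0 < d\<close> by (subst ennreal_mult) auto
      finally show ?case
        by (simp add: ennreal_mult_le_mult_iff)
    qed
  qed
  then show ?thesis
  proof eventually_elim
    case (elim x)
    have "(\<lambda>m. ennreal (u x * v x + (u x + v x) / 2 * inverse (real (Suc m))))
        \<longlonglongrightarrow> ennreal (u x * v x + (u x + v x) / 2 * 0)"
      by (intro tendsto_ennrealI tendsto_intros LIMSEQ_inverse_real_of_nat)
    with elim show ?case
      by (intro LIMSEQ_le_const) auto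
  qed
qed

text \<open>Integrating out the newest coordinate first makes the cross term linear in a centred
  vector, so it vanishes and each coordinate contributes the same variance. Square integrability is
  what allows the square to be expanded under the integral.\<close>

lemma nn_integral_norm_sum_iid:
  fixes u :: "'s \<Rightarrow> 'b :: {real_inner, banach, second_countable_topology}"
  assumes P: "prob_space P" and int: "integrable P u" and mean: "(\<integral>z. u z \<partial>P) = 0"
    and square: "integrable P (\<lambda>z. (norm (u z))\<^sup>2)" and "finite I"
  shows "(\<integral>\<^sup>+ s. ennreal ((norm (\<Sum>i\<in>I. u (s i)))\<^sup>2) \<partial>Pi\<^sub>M I (\<lambda>_. P))
    = of_nat (card I) * (\<integral>\<^sup>+ z. ennreal ((norm (u z))\<^sup>2) \<partial>P)"
  using \<open>finite I\<close>
proof induction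
  case empty
  then show ?case by simp
next
  case (insert j I)
  interpret P: prob_space P by fact
  interpret product_sigma_finite "\<lambda>_. P" ..
  interpret PI: prob_space "Pi\<^sub>M I (\<lambda>_. P)"
    by (intro prob_space_PiM P)
  have [measurable]: "u \<in> borel_measurable P"
    using int by (rule borel_measurable_integrable)
  define v where "v = (\<integral>z. (norm (u z))\<^sup>2 \<partial>P)"
  have v: "(\<integral>\<^sup>+ z. ennreal ((norm (u z))\<^sup>2) \<partial>P) = ennreal v" "0 \<le> v"
    unfolding v_def using square by (auto intro!: nn_integral_eq_integral)
  have inner: "(\<integral>\<^sup>+ z. ennreal ((norm (u z + w))\<^sup>2) \<partial>P) = ennreal ((norm w)\<^sup>2) + ennreal v" for w
  proof -
    have eq: "(norm (u z + w))\<^sup>2 = (norm (u z))\<^sup>2 + 2 * inner (u z) w + (norm w)\<^sup>2" for z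
      by (simp add: power2_norm_eq_inner inner_add_left inner_add_right inner_commute)
    have i: "integrable P (\<lambda>z. inner (u z) w)"
      using int by simp
    have "(\<integral>z. inner (u z) w \<partial>P) = 0"
      using int mean by (simp)
    then have "(\<integral>z. (norm (u z + w))\<^sup>2 \<partial>P) = v + (norm w)\<^sup>2"
      unfolding eq v_def using square i by (simp add: P.prob_space)
    moreover have "integrable P (\<lambda>z. (norm (u z + w))\<^sup>2)"
      unfolding eq using square i by simp
    ultimately show ?thesis
      using v by (subst nn_integral_eq_integral) (auto simp: ennreal_plus add.commute)
  qed
  have "(\<integral>\<^sup>+ s. ennreal ((norm (\<Sum>i\<in>insert j I. u (s i)))\<^sup>2) \<partial>Pi\<^sub>M (insert j I) (\<lambda>_. P))
      = (\<integral>\<^sup>+ s. (\<integral>\<^sup>+ z. ennreal ((norm (\<Sum>i\<in>insert j I. u ((s(j := z)) i)))\<^sup>2) \<partial>P) \<partial>Pi\<^sub>M I (\<lambda>_. P))"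
    using insert by (intro product_nn_integral_insert) auto
  also have "\<dots> = (\<integral>\<^sup>+ s. (\<integral>\<^sup>+ z. ennreal ((norm (u z + (\<Sum>i\<in>I. u (s i))))\<^sup>2) \<partial>P) \<partial>Pi\<^sub>M I (\<lambda>_. P))"
  proof (intro nn_integral_cong)
    fix s z
    have "(\<Sum>i\<in>insert j I. u ((s(j := z)) i)) = u z + (\<Sum>i\<in>I. u (s i))"
      using insert by (auto intro!: sum.cong)
    then show "ennreal ((norm (\<Sum>i\<in>insert j I. u ((s(j := z)) i)))\<^sup>2)
        = ennreal ((norm (u z + (\<Sum>i\<in>I. u (s i))))\<^sup>2)"
      by simp
  qed
  also have "\<dots> = (\<integral>\<^sup>+ s. ennreal ((norm (\<Sum>i\<in>I. u (s i)))\<^sup>2) \<partial>Pi\<^sub>M I (\<lambda>_. P)) + ennreal v"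
    unfolding inner by (subst nn_integral_add) (auto simp: PI.emeasure_space_1)
  finally show ?case
    using insert by (simp add: v algebra_simps)
qed

section \<open>Rules for upper bounds on conditional expectations\<close>

lemma (in sigma_finite_subalgebra) nn_cond_exp_add_le:
  assumes [measurable]: "f \<in> borel_measurable M" "g \<in> borel_measurable M"
    and "\<And>x. 0 \<le> u x" "\<And>x. 0 \<le> v x"
    and "AE x in M. nn_cond_exp M F f x \<le> ennreal (u x)" "AE x in M. nn_cond_exp M F g x \<le> ennreal (v x)"
  shows "AE x in M. nn_cond_exp M F (\<lambda>x. f x + g x) x \<le> ennreal (u x + v x)"
  using nn_cond_exp_sum[OF assms(1,2)] assms(5,6)
proof eventually_elim
  case (elim x)
  then show ?case
    using add_mono[OF elim(2,3)] assms(3,4) by (simp add: ennreal_plus)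
qed

lemma (in sigma_finite_subalgebra) nn_cond_exp_cmult_le:
  assumes [measurable]: "f \<in> borel_measurable M" and "0 \<le> r"
    and "AE x in M. nn_cond_exp M F f x \<le> ennreal (u x)"
  shows "AE x in M. nn_cond_exp M F (\<lambda>x. ennreal r * f x) x \<le> ennreal (r * u x)"
  using nn_cond_exp_prod[OF borel_measurable_const assms(1), of "ennreal r"] assms(3)
proof eventually_elim
  case (elim x)
  then show ?case
    using mult_left_mono[OF elim(2), of "ennreal r"] assms(2) by (simp add: ennreal_mult')
qed

lemma (in sigma_finite_subalgebra) nn_cond_exp_F_meas_le:
  assumes "f \<in> borel_measurable F" "\<And>x. f x \<le> g x"
  shows "AE x in M. nn_cond_exp M F f x \<le> g x"
  using nn_cond_exp_F_meas[OF assms(1)]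
proof eventually_elim
  case (elim x)
  show ?case
    unfolding elim[symmetric] by (rule assms(2))
qed

section \<open>Averaging over a fresh sample\<close>

lemma draws_cong:
  assumes "\<And>i. i < q \<Longrightarrow> s i = t i"
  shows "draws q s = draws q t"
  unfolding draws_def by (rule image_mset_cong) (use assms in auto)

lemma sample_grad_draws:
  "sample_grad gF (draws q s) x = (1 / real q) *\<^sub>R (\<Sum>i<q. gF x (s i))"
  by (simp add: sample_grad_def draws_def image_mset.compositionality comp_def sum_unfold_sum_mset)

locale sampling = prob_space M + P: prob_space P
  for M :: "'w measure" and P :: "'s measure" +
  fixes x0 :: "'w \<Rightarrow> real ^ 'n" and l0 :: "'w \<Rightarrow> real ^ 'm"
    and n :: "nat \<Rightarrow> 'w \<Rightarrow> nat" and \<xi> :: "nat \<Rightarrow> nat \<Rightarrow> 'w \<Rightarrow> 's"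
  assumes sampling: "random_sampling M P x0 l0 n \<xi>"
begin

abbreviation hist :: "nat \<Rightarrow> 'w measure" where
  "hist \<equiv> history M P x0 l0 n \<xi>"

text \<open>Restricting to the drawn indices yields a point of the finite product space over
  \<open>{..<n k \<omega>}\<close>. That space itself depends on \<omega>, so measurability can only
  be discussed after fixing the value of \<open>n k\<close>.\<close>

abbreviation samples :: "nat \<Rightarrow> 'w \<Rightarrow> nat \<Rightarrow> 's" where
  "samples k \<omega> \<equiv> \<lambda>i\<in>{..<n k \<omega>}. \<xi> k i \<omega>"

section \<open>The filtration of histories\<close>

lemma measurable_x0 [measurable]: "x0 \<in> borel_measurable M"
  and measurable_l0 [measurable]: "l0 \<in> borel_measurable M"
  and measurable_\<xi> [measurable]: "\<xi> k i \<in> measurable M P"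
  and measurable_n_hist: "n k \<in> measurable (hist k) (count_space UNIV)"
  and n_pos: "\<omega> \<in> space M \<Longrightarrow> 1 \<le> n k \<omega>"
  using sampling by (auto simp: random_sampling_def)

lemma space_hist [simp]: "space (hist k) = space M"
  unfolding history_def by (subst space_measure_of) auto

lemma sets_hist: "sets (hist k) = sigma_sets (space M)
     ({x0 -` B \<inter> space M | B. B \<in> sets borel} \<union>
      {l0 -` B \<inter> space M | B. B \<in> sets borel} \<union>
      {{\<omega> \<in> space M. n i \<omega> = q} | i q. i < k} \<union>
      {{\<omega> \<in> space M. j < n i \<omega> \<and> \<xi> i j \<omega> \<in> B} | i j B. i < k \<and> B \<in> sets P})"
  unfolding history_def by (subst sets_measure_of) auto

lemma sets_hist_mono:
  assumes "k \<le> l"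
  shows "sets (hist k) \<subseteq> sets (hist l)"
  unfolding sets_hist
proof (intro sigma_sets_mono' Un_mono order_refl subsetI)
  fix A assume "A \<in> {{\<omega> \<in> space M. n i \<omega> = q} | i q. i < k}"
  then show "A \<in> {{\<omega> \<in> space M. n i \<omega> = q} | i q. i < l}"
    using assms less_le_trans by blast
next
  fix A assume "A \<in> {{\<omega> \<in> space M. j < n i \<omega> \<and> \<xi> i j \<omega> \<in> B} | i j B. i < k \<and> B \<in> sets P}"
  then show "A \<in> {{\<omega> \<in> space M. j < n i \<omega> \<and> \<xi> i j \<omega> \<in> B} | i j B. i < l \<and> B \<in> sets P}"
    using assms less_le_trans by blast
qed

text \<open>Strong induction is forced by the assumptions: the generators of \<open>hist k\<close>
  involve \<open>n i\<close> for \<open>i < k\<close>, and \<open>n i\<close> is known to be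
  measurable only with respect to \<open>hist i\<close>.\<close>

lemma subalgebra_hist: "subalgebra M (hist k)"
proof (induction k rule: less_induct)
  case (less k)
  have [measurable]: "n i \<in> measurable M (count_space UNIV)" if "i < k" for i
    using measurable_from_subalg[OF less[OF that] measurable_n_hist] .
  show ?case
    unfolding subalgebra_def
  proof
    show "sets (hist k) \<subseteq> sets M"
      unfolding sets_hist by (rule sets.sigma_sets_subset) auto
  qed simp
qed

lemma measurable_n [measurable]: "n k \<in> measurable M (count_space UNIV)"
  by (rule measurable_from_subalg[OF subalgebra_hist measurable_n_hist])

lemma subalgebra_hist_le: "k \<le> l \<Longrightarrow> subalgebra (hist l) (hist k)"
  using sets_hist_mono by (simp add: subalgebra_def)

lemma measurable_hist_mono: "f \<in> measurable (hist k) L \<Longrightarrow> k \<le> l \<Longrightarrow> f \<in> measurable (hist l) L"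
  by (rule measurable_from_subalg[OF subalgebra_hist_le])

lemma sigma_finite_subalgebra_hist: "sigma_finite_subalgebra M (hist k)"
  by (intro finite_measure_subalgebra_is_sigma_finite finite_measure_subalgebra.intro
      finite_measure_axioms finite_measure_subalgebra_axioms.intro subalgebra_hist)

lemma hist_drawn:
  assumes "B \<in> sets P"
  shows "{\<omega> \<in> space M. i < n k \<omega> \<and> \<xi> k i \<omega> \<in> B} \<in> sets (hist (Suc k))"
  unfolding sets_hist using assms by (intro sigma_sets.Basic UnI2 CollectI) blast

lemma measurable_x0_hist: "x0 \<in> borel_measurable (hist k)"
proof (rule measurableI)
  fix B :: "(real ^ 'n) set" assume "B \<in> sets borel"
  then show "x0 -` B \<inter> space (hist k) \<in> sets (hist k)"
    unfolding space_hist sets_hist by (intro sigma_sets.Basic UnI1 CollectI) blast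
qed simp

lemma measurable_l0_hist: "l0 \<in> borel_measurable (hist k)"
proof (rule measurableI)
  fix B :: "(real ^ 'm) set" assume "B \<in> sets borel"
  then show "l0 -` B \<inter> space (hist k) \<in> sets (hist k)"
    unfolding space_hist sets_hist
    by - (rule sigma_sets.Basic, rule UnI1, rule UnI1, rule UnI2, blast)
qed simp

text \<open>
  \<open>\<xi> k i\<close> itself need not be measurable for the history, only on the event \<open>i < n k\<close>; hence the
  case distinction on the value of \<open>n k\<close>. The measure \<open>K\<close> allows for restrictions of the history.
\<close>

lemma measurable_samples:
  assumes K: "(\<lambda>\<omega>. \<omega>) \<in> measurable K (hist (Suc k))"
    and Y: "Y \<in> measurable K L"
    and h: "\<And>q. (\<lambda>(s, y). h q s y) \<in> measurable (Pi\<^sub>M {..<q} (\<lambda>_. P) \<Otimes>\<^sub>M L) N"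
  shows "(\<lambda>\<omega>. h (n k \<omega>) (samples k \<omega>) (Y \<omega>)) \<in> measurable K N"
proof (rule measurable_piecewise_restrict)
  let ?C = "range (\<lambda>q. {\<omega> \<in> space M. n k \<omega> = q})"
  have nK: "n k \<in> measurable K (count_space UNIV)"
    using measurable_compose[OF K measurable_hist_mono[OF measurable_n_hist]] by simp
  have space_K: "\<omega> \<in> space M" if "\<omega> \<in> space K" for \<omega>
    using measurable_space[OF K that] by simp
  show "countable ?C" by simp
  show "space K \<subseteq> \<Union> ?C" using space_K by auto
  have \<Omega>: "{\<omega> \<in> space M. n k \<omega> = q} \<inter> space K \<in> sets K" for q
  proof -
    have "{\<omega> \<in> space M. n k \<omega> = q} \<inter> space K = n k -` {q} \<inter> space K"
      using space_K by auto
    then show ?thesis using measurable_sets[OF nK, of "{q}"] by simp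
  qed
  then show "\<Omega> \<inter> space K \<in> sets K" if "\<Omega> \<in> ?C" for \<Omega>
    using that by auto
  show "(\<lambda>\<omega>. h (n k \<omega>) (samples k \<omega>) (Y \<omega>)) \<in> measurable (restrict_space K \<Omega>) N" if "\<Omega> \<in> ?C" for \<Omega>
  proof -
    from that obtain q where q: "\<Omega> = {\<omega> \<in> space M. n k \<omega> = q}" by auto
    let ?K = "restrict_space K \<Omega>"
    have sp: "space ?K = {\<omega> \<in> space K. n k \<omega> = q}"
      using space_K by (auto simp: q space_restrict_space)
    have "\<xi> k i \<in> measurable ?K P" if "i < q" for i
    proof (rule measurableI)
      fix \<omega> assume "\<omega> \<in> space ?K"
      then show "\<xi> k i \<omega> \<in> space P"
        using space_K measurable_space[OF measurable_\<xi>] by (auto simp: sp)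
    next
      fix B assume B: "B \<in> sets P"
      let ?A = "{\<omega> \<in> space M. i < n k \<omega> \<and> \<xi> k i \<omega> \<in> B}"
      have "?A \<inter> space K \<in> sets K"
        using measurable_sets[OF K hist_drawn[OF B]] by simp
      then have "\<Omega> \<inter> (?A \<inter> space K) \<in> sets ?K"
        by (auto simp: sets_restrict_space)
      \<comment> \<open>On this piece \<open>n k\<close> equals \<open>q\<close>, so the guard
        \<open>i < n k\<close> in the generating events of the history holds automatically for
        \<open>i < q\<close>.\<close>
      moreover have "\<xi> k i -` B \<inter> space ?K = \<Omega> \<inter> (?A \<inter> space K)"
        using that space_K unfolding sp by (auto simp: q)
      ultimately show "\<xi> k i -` B \<inter> space ?K \<in> sets ?K" by simp
    qed
    then have s: "(\<lambda>\<omega>. \<lambda>i\<in>{..<q}. \<xi> k i \<omega>) \<in> measurable ?K (Pi\<^sub>M {..<q} (\<lambda>_. P))"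
      by (intro measurable_restrict) auto
    have "(\<lambda>\<omega>. h q (\<lambda>i\<in>{..<q}. \<xi> k i \<omega>) (Y \<omega>)) \<in> measurable ?K N"
      using measurable_compose[OF measurable_Pair[OF s measurable_restrict_space1[OF Y]] h] by simp
    then show ?thesis
      by (rule measurable_cong[THEN iffD1, rotated]) (simp add: sp)
  qed
qed

text \<open>The sampling assumption speaks of rectangles only. As functions of \<open>C\<close>,
  both sides are finite measures on the product space; they agree on rectangles, hence
  everywhere.\<close>

lemma emeasure_samples:
  assumes A: "A \<in> sets (hist k)" "A \<subseteq> {\<omega>. n k \<omega> = q}" and C: "C \<in> sets (Pi\<^sub>M {..<q} (\<lambda>_. P))"
  shows "emeasure M {\<omega> \<in> A. (\<lambda>i\<in>{..<q}. \<xi> k i \<omega>) \<in> C} = emeasure M A * emeasure (Pi\<^sub>M {..<q} (\<lambda>_. P)) C"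
proof -
  let ?PI = "Pi\<^sub>M {..<q} (\<lambda>_. P)" and ?X = "\<lambda>\<omega>. \<lambda>i\<in>{..<q}. \<xi> k i \<omega>"
  interpret PI: prob_space ?PI
    by (intro prob_space_PiM P.prob_space_axioms)
  interpret PP: product_sigma_finite "\<lambda>_. P" ..
  have AM [measurable]: "A \<in> sets M"
    using A subalgebra_hist by (auto simp: subalgebra_def)
  have X [measurable]: "?X \<in> measurable M ?PI"
    by (intro measurable_restrict) auto
  \<comment> \<open>The law of the batch under \<open>M\<close> restricted to \<open>A\<close>; its
    total mass is that of \<open>A\<close>.\<close>
  define \<mu> where "\<mu> = distr (density M (indicator A)) ?PI ?X"
  have \<mu>: "emeasure \<mu> D = emeasure M {\<omega> \<in> A. ?X \<omega> \<in> D}" if D: "D \<in> sets ?PI" for D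
  proof -
    have "A \<inter> (?X -` D \<inter> space M) = {\<omega> \<in> A. ?X \<omega> \<in> D}"
      using sets.sets_into_space[OF AM] by auto
    moreover have "emeasure \<mu> D = emeasure M (A \<inter> (?X -` D \<inter> space M))"
      unfolding \<mu>_def using D
      by (subst emeasure_distr) (auto simp: emeasure_density nn_integral_indicator' mult_indicator_subset
          measurable_sets[OF X] simp flip: indicator_inter_arith intro!: nn_integral_indicator sets.Int)
    ultimately show ?thesis by simp
  qed
  have "density ?PI (\<lambda>_. emeasure M A) = \<mu>"
  proof (rule measure_eqI_PiM_finite[where I = "{..<q}" and M = "\<lambda>_. P" and A = "\<lambda>_. space ?PI"])
    show "sets (density ?PI (\<lambda>_. emeasure M A)) = sets ?PI" "sets \<mu> = sets ?PI"
      by (auto simp: \<mu>_def)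
    fix B assume B: "\<And>i. i \<in> {..<q} \<Longrightarrow> B i \<in> sets P"
    have "{\<omega> \<in> A. n k \<omega> = q \<and> (\<forall>i<q. \<xi> k i \<omega> \<in> B i)} = {\<omega> \<in> A. ?X \<omega> \<in> Pi\<^sub>E {..<q} B}" "{\<omega> \<in> A. n k \<omega> = q} = A"
      using A(2) by (auto simp: PiE_iff)
    moreover have "measure M {\<omega> \<in> A. n k \<omega> = q \<and> (\<forall>i<q. \<xi> k i \<omega> \<in> B i)}
          = measure M {\<omega> \<in> A. n k \<omega> = q} * (\<Prod>i<q. measure P (B i))"
      using sampling A(1) B unfolding random_sampling_def by (auto simp: lessThan_iff)
    ultimately have "measure M {\<omega> \<in> A. ?X \<omega> \<in> Pi\<^sub>E {..<q} B} = measure M A * (\<Prod>i<q. measure P (B i))"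
      by simp
    then have "emeasure M {\<omega> \<in> A. ?X \<omega> \<in> Pi\<^sub>E {..<q} B} = emeasure M A * (\<Prod>i<q. emeasure P (B i))"
      by (simp add: emeasure_eq_measure P.emeasure_eq_measure ennreal_mult prod_nonneg prod_ennreal)
    moreover have "Pi\<^sub>E {..<q} B \<in> sets ?PI"
      using B by (intro sets_PiM_I_finite) auto
    moreover have "emeasure ?PI (Pi\<^sub>E {..<q} B) = (\<Prod>i<q. emeasure P (B i))"
      using B by (intro PP.emeasure_PiM) auto
    ultimately show "emeasure (density ?PI (\<lambda>_. emeasure M A)) (Pi\<^sub>E {..<q} B) = emeasure \<mu> (Pi\<^sub>E {..<q} B)"
      using B by (simp add: \<mu> emeasure_density nn_integral_cmult)
  next
    show "range (\<lambda>_::nat. space ?PI) \<subseteq> prod_algebra {..<q} (\<lambda>_. P)"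
      using prod_algebraI_finite[of "{..<q}" "\<lambda>_. space P" "\<lambda>_. P"] by (auto simp: space_PiM)
    show "(\<Union>i::nat. space ?PI) = space ?PI" by simp
    show "emeasure (density ?PI (\<lambda>_. emeasure M A)) (space ?PI) \<noteq> \<infinity>" for i :: nat
      by (simp add: emeasure_density nn_integral_cmult PI.emeasure_space_1)
  qed simp
  then have "emeasure \<mu> C = emeasure (density ?PI (\<lambda>_. emeasure M A)) C" by simp
  with C show ?thesis
    by (simp add: \<mu> emeasure_density nn_integral_cmult)
qed

text \<open>Under \<open>M\<close> restricted to \<open>A\<close>, the joint law of the batch and
  \<open>Y\<close> is a product measure, so the claim is Tonelli's theorem. Values of
  \<open>Y\<close> can be fixed along with \<open>A\<close>, because \<open>A\<close> intersected
  with an event of \<open>Y\<close> is again an event of the history.\<close>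

lemma nn_integral_samples:
  assumes A: "A \<in> sets (hist k)" "A \<subseteq> {\<omega>. n k \<omega> = q}"
    and Y: "Y \<in> measurable (hist k) L"
    and h [measurable]: "(\<lambda>(s, y). h s y) \<in> borel_measurable (Pi\<^sub>M {..<q} (\<lambda>_. P) \<Otimes>\<^sub>M L)"
  shows "(\<integral>\<^sup>+\<omega>\<in>A. h (\<lambda>i\<in>{..<q}. \<xi> k i \<omega>) (Y \<omega>) \<partial>M)
    = (\<integral>\<^sup>+\<omega>\<in>A. (\<integral>\<^sup>+ s. h s (Y \<omega>) \<partial>Pi\<^sub>M {..<q} (\<lambda>_. P)) \<partial>M)"
proof -
  let ?PI = "Pi\<^sub>M {..<q} (\<lambda>_. P)" and ?X = "\<lambda>\<omega>. \<lambda>i\<in>{..<q}. \<xi> k i \<omega>"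
  let ?D = "density M (indicator A)"
  interpret PI: prob_space ?PI by (intro prob_space_PiM P.prob_space_axioms)
  have AM [measurable]: "A \<in> sets M"
    using A subalgebra_hist by (auto simp: subalgebra_def)
  have X [measurable]: "?X \<in> measurable M ?PI"
    by (intro measurable_restrict) auto
  have YM [measurable]: "Y \<in> measurable M L"
    by (rule measurable_from_subalg[OF subalgebra_hist Y])
  have D: "emeasure ?D B = emeasure M (A \<inter> B)" if "B \<in> sets M" for B
    using that by (simp add: emeasure_density flip: indicator_inter_arith)
  define \<nu> where "\<nu> = distr ?D L Y"
  interpret \<nu>: finite_measure \<nu>
    unfolding \<nu>_def by (intro finite_measure.finite_measure_distr finite_measureI) (auto simp: D)
  interpret pair_sigma_finite ?PI \<nu> ..
  have "?PI \<Otimes>\<^sub>M \<nu> = distr ?D (?PI \<Otimes>\<^sub>M L) (\<lambda>\<omega>. (?X \<omega>, Y \<omega>))"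
  proof (rule pair_measure_eqI)
    show "sigma_finite_measure ?PI" "sigma_finite_measure \<nu>"
      by (rule PI.sigma_finite_measure_axioms, rule \<nu>.sigma_finite_measure_axioms)
    show "sets (?PI \<Otimes>\<^sub>M \<nu>) = sets (distr ?D (?PI \<Otimes>\<^sub>M L) (\<lambda>\<omega>. (?X \<omega>, Y \<omega>)))"
      unfolding \<nu>_def sets_distr by (intro sets_pair_measure_cong) auto
    fix B C assume B: "B \<in> sets ?PI" and "C \<in> sets \<nu>"
    then have C: "C \<in> sets L" by (simp add: \<nu>_def)
    let ?A = "A \<inter> (Y -` C \<inter> space M)"
    have "?A \<in> sets (hist k)"
      using A measurable_sets[OF Y C] by auto
    then have "emeasure M {\<omega> \<in> ?A. ?X \<omega> \<in> B} = emeasure M ?A * emeasure ?PI B"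
      using A B by (intro emeasure_samples) auto
    moreover have "{\<omega> \<in> ?A. ?X \<omega> \<in> B} = A \<inter> ((\<lambda>\<omega>. (?X \<omega>, Y \<omega>)) -` (B \<times> C) \<inter> space M)"
      by auto
    ultimately show "emeasure ?PI B * emeasure \<nu> C
        = emeasure (distr ?D (?PI \<Otimes>\<^sub>M L) (\<lambda>\<omega>. (?X \<omega>, Y \<omega>))) (B \<times> C)"
      using B C by (simp add: \<nu>_def emeasure_distr D measurable_sets[OF YM] mult.commute
          measurable_sets[of "\<lambda>\<omega>. (?X \<omega>, Y \<omega>)" M "?PI \<Otimes>\<^sub>M L"])
  qed
  note eq = this
  have sets_\<nu> [measurable_cong]: "sets \<nu> = sets L" by (simp add: \<nu>_def)
  have "(\<integral>\<^sup>+\<omega>\<in>A. h (?X \<omega>) (Y \<omega>) \<partial>M) = (\<integral>\<^sup>+\<omega>. h (?X \<omega>) (Y \<omega>) \<partial>?D)"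
    by (subst nn_integral_density) (auto simp: mult.commute)
  also have "\<dots> = (\<integral>\<^sup>+p. (\<lambda>(s, y). h s y) p \<partial>(?PI \<Otimes>\<^sub>M \<nu>))"
    unfolding eq by (subst nn_integral_distr) auto
  also have "\<dots> = (\<integral>\<^sup>+y. (\<integral>\<^sup>+s. h s y \<partial>?PI) \<partial>\<nu>)"
    by (subst nn_integral_snd[symmetric]) auto
  also have "\<dots> = (\<integral>\<^sup>+\<omega>. (\<integral>\<^sup>+s. h s (Y \<omega>) \<partial>?PI) \<partial>?D)"
    unfolding \<nu>_def by (subst nn_integral_distr) auto
  also have "\<dots> = (\<integral>\<^sup>+\<omega>\<in>A. (\<integral>\<^sup>+ s. h s (Y \<omega>) \<partial>?PI) \<partial>M)"
    by (subst nn_integral_density) (auto simp: mult.commute)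
  finally show ?thesis .
qed

text \<open>The freezing principle: given the history, whatever is measurable for it is held
  constant and the fresh batch is integrated out. The integrand carries the batch size as a
  parameter because the space of batches depends on it.\<close>

lemma nn_cond_exp_samples:
  assumes Y: "Y \<in> measurable (hist k) L"
    and h [measurable]: "\<And>q. (\<lambda>(s, y). h q s y) \<in> borel_measurable (Pi\<^sub>M {..<q} (\<lambda>_. P) \<Otimes>\<^sub>M L)"
  shows "AE \<omega> in M. nn_cond_exp M (hist k) (\<lambda>\<omega>. h (n k \<omega>) (samples k \<omega>) (Y \<omega>)) \<omega>
    = (\<integral>\<^sup>+ s. h (n k \<omega>) s (Y \<omega>) \<partial>Pi\<^sub>M {..<n k \<omega>} (\<lambda>_. P))"
proof -
  interpret sigma_finite_subalgebra M "hist k"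
    by (rule sigma_finite_subalgebra_hist)
  interpret PI: sigma_finite_measure "Pi\<^sub>M {..<q} (\<lambda>_. P)" for q
    by (intro prob_space_imp_sigma_finite prob_space_PiM P.prob_space_axioms)
  let ?f = "\<lambda>\<omega>. h (n k \<omega>) (samples k \<omega>) (Y \<omega>)"
  let ?g = "\<lambda>\<omega>. \<integral>\<^sup>+ s. h (n k \<omega>) s (Y \<omega>) \<partial>Pi\<^sub>M {..<n k \<omega>} (\<lambda>_. P)"
  have id: "(\<lambda>\<omega>. \<omega>) \<in> measurable (hist (Suc k)) (hist (Suc k))" by simp
  have f: "?f \<in> borel_measurable M"
    by (rule measurable_from_subalg[OF subalgebra_hist],
        rule measurable_samples[OF id measurable_hist_mono[OF Y] h]) simp
  have inner [measurable]: "(\<lambda>y. \<integral>\<^sup>+ s. h q s y \<partial>Pi\<^sub>M {..<q} (\<lambda>_. P)) \<in> borel_measurable L" for q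
    by measurable
  have g: "?g \<in> borel_measurable (hist k)"
    by (rule measurable_compose_countable[OF measurable_compose[OF Y inner] measurable_n_hist])
  have gM: "?g \<in> borel_measurable M"
    by (rule measurable_from_subalg[OF subalgebra_hist g])
  have "AE \<omega> in M. ?g \<omega> = nn_cond_exp M (hist k) ?f \<omega>"
  proof (rule nn_cond_exp_charact[OF _ f g])
    fix A assume A: "A \<in> sets (hist k)"
    \<comment> \<open>The identity is tested on an arbitrary event of the history, cut into
      countably many pieces of constant batch size. The pieces remain in the history because
      \<open>n k\<close> is measurable for it.\<close>
    define B where "B q = A \<inter> {\<omega> \<in> space M. n k \<omega> = q}" for q
    have "{\<omega> \<in> space M. n k \<omega> = q} \<in> sets (hist k)" for q
      using measurable_sets[OF measurable_n_hist, of "{q}" k]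
      by (simp add: vimage_def Int_def conj_commute)
    then have B: "B q \<in> sets (hist k)" for q
      unfolding B_def by (rule sets.Int[OF A])
    then have BM: "B q \<in> sets M" for q
      using subalgebra_hist by (auto simp: subalgebra_def)
    have A_eq: "A = (\<Union>q. B q)"
      using sets.sets_into_space[OF A] by (auto simp: B_def)
    have disj: "disjoint_family B"
      by (auto simp: disjoint_family_on_def B_def)
    have "(\<integral>\<^sup>+\<omega>\<in>B q. ?f \<omega> \<partial>M) = (\<integral>\<^sup>+\<omega>\<in>B q. ?g \<omega> \<partial>M)" for q
    proof -
      have "(\<integral>\<^sup>+\<omega>\<in>B q. ?f \<omega> \<partial>M) = (\<integral>\<^sup>+\<omega>\<in>B q. h q (\<lambda>i\<in>{..<q}. \<xi> k i \<omega>) (Y \<omega>) \<partial>M)"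
        by (intro nn_integral_cong) (auto simp: indicator_def B_def)
      also have "\<dots> = (\<integral>\<^sup>+\<omega>\<in>B q. (\<integral>\<^sup>+ s. h q s (Y \<omega>) \<partial>Pi\<^sub>M {..<q} (\<lambda>_. P)) \<partial>M)"
        by (rule nn_integral_samples[OF B _ Y h]) (auto simp: B_def)
      also have "\<dots> = (\<integral>\<^sup>+\<omega>\<in>B q. ?g \<omega> \<partial>M)"
        by (intro nn_integral_cong) (auto simp: indicator_def B_def)
      finally show ?thesis .
    qed
    then show "(\<integral>\<^sup>+\<omega>\<in>A. ?f \<omega> \<partial>M) = (\<integral>\<^sup>+\<omega>\<in>A. ?g \<omega> \<partial>M)"
      unfolding A_eq nn_integral_disjoint_family[OF f BM disj] nn_integral_disjoint_family[OF gM BM disj]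
      by (rule suminf_cong)
  qed
  then show ?thesis
    by eventually_elim (rule sym)
qed

end

section \<open>The randomized outer iteration\<close>

lemma borel_measurable_fst_borel:
  fixes f :: "'a \<Rightarrow> 'b::topological_space \<times> 'c::topological_space"
  shows "f \<in> borel_measurable K \<Longrightarrow> (\<lambda>\<omega>. fst (f \<omega>)) \<in> borel_measurable K"
  by (rule borel_measurable_continuous_on) (auto intro: continuous_intros)

lemma borel_measurable_snd_borel:
  fixes f :: "'a \<Rightarrow> 'b::topological_space \<times> 'c::topological_space"
  shows "f \<in> borel_measurable K \<Longrightarrow> (\<lambda>\<omega>. snd (f \<omega>)) \<in> borel_measurable K"
  by (rule borel_measurable_continuous_on) (auto intro: continuous_intros)

lemma borel_measurable_transpose_vector_mult:
  fixes A :: "'a \<Rightarrow> real ^ 'n ^ 'm" and v :: "'a \<Rightarrow> real ^ 'm"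
  assumes "A \<in> borel_measurable K" "v \<in> borel_measurable K"
  shows "(\<lambda>\<omega>. transpose (A \<omega>) *v v \<omega>) \<in> borel_measurable K"
  by (rule borel_measurable_continuous_Pair[OF assms])
    (auto simp: matrix_vector_mult_def transpose_def vector_matrix_mult_def
      intro!: continuous_intros continuous_on_vec_lambda simp del: transpose_matrix_vector)

locale retro_expectation = sampling M P x0 l0 n \<xi>
  for M :: "'w measure" and P :: "'s measure"
    and x0 :: "'w \<Rightarrow> real ^ 'n" and l0 :: "'w \<Rightarrow> real ^ 'm"
    and n :: "nat \<Rightarrow> 'w \<Rightarrow> nat" and \<xi> :: "nat \<Rightarrow> nat \<Rightarrow> 'w \<Rightarrow> 's" +
  fixes \<X> :: "(real ^ 'n) set"
    and f :: "real ^ 'n \<Rightarrow> real" and gf :: "real ^ 'n \<Rightarrow> real ^ 'n"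
    and c :: "real ^ 'n \<Rightarrow> real ^ 'm" and J :: "real ^ 'n \<Rightarrow> real ^ 'n ^ 'm"
    and F :: "real ^ 'n \<Rightarrow> 's \<Rightarrow> real" and gF :: "real ^ 'n \<Rightarrow> 's \<Rightarrow> real ^ 'n"
    and solver :: "nat \<Rightarrow> 's multiset \<Rightarrow> (real ^ 'n) \<times> (real ^ 'm) \<Rightarrow> nat \<Rightarrow> (real ^ 'n) \<times> (real ^ 'm)"
    and \<gamma> :: "nat \<Rightarrow> real" and \<epsilon> :: "nat \<Rightarrow> 'w \<Rightarrow> real"
    and x :: "nat \<Rightarrow> nat \<Rightarrow> 'w \<Rightarrow> real ^ 'n" and lam :: "nat \<Rightarrow> nat \<Rightarrow> 'w \<Rightarrow> real ^ 'm"
    and N :: "nat \<Rightarrow> 'w \<Rightarrow> nat"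
  assumes problem: "smooth_problem \<X> f gf c J"
    and expectation: "expectation_problem \<X> P f gf F gF"
    and choices: "measurable_choices M P x0 l0 n \<xi> solver \<epsilon> lam"
    and run: "\<And>\<omega>. \<omega> \<in> space M \<Longrightarrow>
          retro_run gF c J solver (\<lambda>k. draws (n k \<omega>) (\<lambda>i. \<xi> k i \<omega>)) \<gamma> (\<lambda>k. \<epsilon> k \<omega>)
            (x0 \<omega>) (l0 \<omega>) (\<lambda>k j. x k j \<omega>) (\<lambda>k j. lam k j \<omega>) (\<lambda>k. N k \<omega>)"
    and stop: "\<And>\<omega> k. \<omega> \<in> space M \<Longrightarrow>
          \<exists>j. inner_stop gF c J (\<lambda>k. draws (n k \<omega>) (\<lambda>i. \<xi> k i \<omega>)) \<gamma> (\<lambda>k. \<epsilon> k \<omega>)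
                     (\<lambda>k j. x k j \<omega>) (\<lambda>k j. lam k j \<omega>) k j"
    and dom: "\<And>\<omega> k j. \<omega> \<in> space M \<Longrightarrow> j \<le> N k \<omega> \<Longrightarrow> x k j \<omega> \<in> \<X>"
begin

text \<open>The gradients, \<open>c\<close> and \<open>J\<close> are controlled on
  \<open>\<X>\<close> only, so they are treated as measurable on the trace of the Borel sets; before
  composing with an iterate one has to know that the iterate lies in \<open>\<X>\<close>.\<close>

abbreviation "dom_borel \<equiv> restrict_space borel \<X>"

abbreviation "batch k \<omega> \<equiv> draws (n k \<omega>) (\<lambda>i. \<xi> k i \<omega>)"

abbreviation "lam_prev k \<omega> \<equiv> outer_prev (l0 \<omega>) (\<lambda>k j. lam k j \<omega>) (\<lambda>k. N k \<omega>) k"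

abbreviation "T_start k \<omega> \<equiv> norm (kkt_residual gf c J (x k 0 \<omega>) (lam_prev k \<omega>))"

abbreviation "T_end k \<omega> \<equiv> norm (kkt_residual gf c J (x k (N k \<omega>) \<omega>) (lam k (N k \<omega>) \<omega>))"

abbreviation "err k \<omega> y \<equiv> norm (gf y - sample_grad gF (batch k \<omega>) y)"

section \<open>Measurability of the iterates, the stopping index and the residuals\<close>

lemma open_dom: "open \<X>"
  using problem by (simp add: smooth_problem_def)

lemma measurable_gf [measurable]: "gf \<in> borel_measurable dom_borel"
  and measurable_J [measurable]: "J \<in> borel_measurable dom_borel"
  and measurable_c [measurable]: "c \<in> borel_measurable dom_borel"
proof -
  have "continuous_on \<X> c"
    using problem unfolding smooth_problem_def
    by (intro continuous_at_imp_continuous_on) (blast intro: has_derivative_continuous)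
  then show "c \<in> borel_measurable dom_borel"
    by (rule borel_measurable_continuous_on_restrict)
qed (use problem in \<open>auto simp: smooth_problem_def intro!: borel_measurable_continuous_on_restrict\<close>)

lemma measurable_gF: "(\<lambda>(y, \<zeta>). gF y \<zeta>) \<in> borel_measurable (dom_borel \<Otimes>\<^sub>M P)"
  using expectation by (simp add: expectation_problem_def)

lemma measurable_gF_compose:
  assumes "Y \<in> measurable K dom_borel" "Z \<in> measurable K P"
  shows "(\<lambda>\<omega>. gF (Y \<omega>) (Z \<omega>)) \<in> borel_measurable K"
  using measurable_compose[OF measurable_Pair[OF assms] measurable_gF] by simp

lemma measurable_sample_grad:
  "(\<lambda>(s, y). sample_grad gF (draws q s) y) \<in> borel_measurable (Pi\<^sub>M {..<q} (\<lambda>_. P) \<Otimes>\<^sub>M dom_borel)"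
proof -
  have "(\<lambda>p. gF (snd p) (fst p i)) \<in> borel_measurable (Pi\<^sub>M {..<q} (\<lambda>_. P) \<Otimes>\<^sub>M dom_borel)" if "i < q" for i
    using that by (intro measurable_gF_compose) auto
  then show ?thesis
    unfolding sample_grad_draws case_prod_beta
    by (intro borel_measurable_scaleR borel_measurable_sum borel_measurable_const) auto
qed

lemma measurable_batch_grad:
  assumes K: "(\<lambda>\<omega>. \<omega>) \<in> measurable K (hist (Suc k))" and Y: "Y \<in> measurable K dom_borel"
  shows "(\<lambda>\<omega>. sample_grad gF (batch k \<omega>) (Y \<omega>)) \<in> borel_measurable K"
proof -
  have "draws (n k \<omega>) (samples k \<omega>) = batch k \<omega>" for \<omega>
    by (rule draws_cong) simp
  then show ?thesis
    using measurable_samples[OF K Y measurable_sample_grad] by simp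
qed

lemma measurable_norm_residual:
  assumes [measurable]: "(\<lambda>\<omega>. g \<omega> (Y \<omega>)) \<in> borel_measurable K" "Y \<in> measurable K dom_borel"
    "L \<in> borel_measurable K"
  shows "(\<lambda>\<omega>. norm (kkt_residual (g \<omega>) c J (Y \<omega>) (L \<omega>))) \<in> borel_measurable K"
proof -
  have [measurable]: "(\<lambda>\<omega>. transpose (J (Y \<omega>)) *v L \<omega>) \<in> borel_measurable K"
    by (intro borel_measurable_transpose_vector_mult measurable_compose[OF _ measurable_J] assms)
  have [measurable]: "(\<lambda>\<omega>. c (Y \<omega>)) \<in> borel_measurable K"
    by (intro measurable_compose[OF _ measurable_c] assms)
  show ?thesis
    unfolding kkt_residual_def norm_Pair by measurable
qed

lemma measurable_dom:
  assumes "Y \<in> borel_measurable (hist k)" "\<And>\<omega>. \<omega> \<in> space M \<Longrightarrow> Y \<omega> \<in> \<X>"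
  shows "Y \<in> measurable (hist k) dom_borel"
  by (rule measurable_restrict_space2) (use assms in auto)

text \<open>For a fixed index an inner iterate is the solver applied to the batch and the starting
  pair, and the batch sees drawn samples only. The assumption on \<open>x k 0\<close> is an
  induction hypothesis, discharged once \<open>N k\<close> is known to be measurable.\<close>

lemma measurable_inner_iterates:
  assumes "x k 0 \<in> borel_measurable (hist k)"
  shows "x k j \<in> borel_measurable (hist (Suc k))" and "lam k j \<in> borel_measurable (hist (Suc k))"
proof -
  have x: "x k 0 \<in> borel_measurable (hist (Suc k))"
    by (rule measurable_hist_mono[OF assms]) simp
  have lam: "lam k 0 \<in> borel_measurable (hist (Suc k))"
    using choices by (simp add: measurable_choices_def)
  have "(\<lambda>(s, z). solver k (draws q s) z j) \<in> borel_measurable (Pi\<^sub>M {..<q} (\<lambda>_. P) \<Otimes>\<^sub>M borel)" for q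
    using choices by (simp add: measurable_choices_def)
  from measurable_samples[OF measurable_ident_sets[OF refl] borel_measurable_Pair[OF x lam] this]
  have "(\<lambda>\<omega>. solver k (draws (n k \<omega>) (samples k \<omega>)) (x k 0 \<omega>, lam k 0 \<omega>) j)
      \<in> borel_measurable (hist (Suc k))" .
  moreover have "draws (n k \<omega>) (samples k \<omega>) = batch k \<omega>" for \<omega>
    by (rule draws_cong) simp
  ultimately have *: "(\<lambda>\<omega>. solver k (batch k \<omega>) (x k 0 \<omega>, lam k 0 \<omega>) j) \<in> borel_measurable (hist (Suc k))"
    by simp
  have eq: "(x k j \<omega>, lam k j \<omega>) = solver k (batch k \<omega>) (x k 0 \<omega>, lam k 0 \<omega>) j" if "\<omega> \<in> space M" for \<omega>
    using run[OF that] unfolding retro_run_def by blast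
  show "x k j \<in> borel_measurable (hist (Suc k))"
    by (rule measurable_cong[THEN iffD2, OF _ borel_measurable_fst_borel[OF *]])
      (simp flip: eq)
  show "lam k j \<in> borel_measurable (hist (Suc k))"
    by (rule measurable_cong[THEN iffD2, OF _ borel_measurable_snd_borel[OF *]])
      (simp flip: eq)
qed

text \<open>
  The residuals are known to be measurable only while the iterate lies in \<open>\<X>\<close>. Up to the stopping
  index all iterates do, so \<open>N k = j\<close> can be expressed through such events alone.
\<close>

lemma measurable_N:
  assumes x: "x k 0 \<in> borel_measurable (hist k)"
  shows "N k \<in> measurable (hist (Suc k)) (count_space UNIV)"
proof -
  let ?H = "hist (Suc k)"
  let ?stop = "\<lambda>j \<omega>. inner_stop gF c J (\<lambda>k. batch k \<omega>) \<gamma> (\<lambda>k. \<epsilon> k \<omega>)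
      (\<lambda>k j. x k j \<omega>) (\<lambda>k j. lam k j \<omega>) k j"
  define X where "X j = {\<omega> \<in> space M. x k j \<omega> \<in> \<X>}" for j
  define S where "S j = {\<omega> \<in> space M. x k j \<omega> \<in> \<X> \<and> ?stop j \<omega>}" for j
  note iter = measurable_inner_iterates[OF x]
  have X: "X j \<in> sets ?H" for j
    using measurable_sets[OF iter(1), of \<X> j] open_dom
    by (simp add: X_def vimage_def Int_def conj_commute)
  have S: "S j \<in> sets ?H" for j
  proof -
    let ?K = "restrict_space ?H (X j)"
    have sp: "space ?K = X j"
      by (auto simp: space_restrict_space X_def)
    have K: "(\<lambda>\<omega>. \<omega>) \<in> measurable ?K ?H"
      by (rule measurable_restrict_space1) simp
    have meas: "h \<in> measurable ?K L" if "h \<in> measurable ?H L" for h and L :: "'z measure"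
      using that by (rule measurable_restrict_space1)
    have Y: "x k j \<in> measurable ?K dom_borel"
    proof (rule measurable_restrict_space2[OF _ meas[OF iter(1)]], rule funcsetI)
      fix \<omega> assume "\<omega> \<in> space ?K"
      then show "x k j \<omega> \<in> \<X>"
        unfolding sp by (simp add: X_def)
    qed
    have "x k 0 \<in> measurable ?H dom_borel"
      using dom by (intro measurable_dom iter) auto
    note Y0 = meas[OF this]
    have "\<epsilon> k \<in> borel_measurable ?H"
      by (rule measurable_hist_mono[of _ k]) (use choices in \<open>simp_all add: measurable_choices_def\<close>)
    note \<epsilon> [measurable] = meas[OF this]
    have [measurable]: "(\<lambda>\<omega>. norm (kkt_residual (sample_grad gF (batch k \<omega>)) c J (x k j \<omega>) (lam k j \<omega>)))
        \<in> borel_measurable ?K"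
      by (rule measurable_norm_residual) (rule measurable_batch_grad[OF K Y], rule Y, rule meas[OF iter(2)])
    have [measurable]: "(\<lambda>\<omega>. norm (kkt_residual (sample_grad gF (batch k \<omega>)) c J (x k 0 \<omega>) (lam k 0 \<omega>)))
        \<in> borel_measurable ?K"
      by (rule measurable_norm_residual) (rule measurable_batch_grad[OF K Y0], rule Y0, rule meas[OF iter(2)])
    have "{\<omega> \<in> space ?K. ?stop j \<omega>} \<in> sets ?K"
      unfolding inner_stop_def by measurable
    moreover have "{\<omega> \<in> space ?K. ?stop j \<omega>} = S j"
      unfolding sp by (auto simp: X_def S_def)
    ultimately show ?thesis
      using X[of j] sets.sets_into_space[OF X[of j]]
      by (simp add: sets_restrict_space_iff Int_absorb2)
  qed
  have "N k -` {j} \<inter> space ?H = S j \<inter> (\<Inter>i\<in>{..<j}. X i - S i) \<inter> space ?H" for j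
  proof (intro set_eqI iffI)
    fix \<omega> assume "\<omega> \<in> N k -` {j} \<inter> space ?H"
    then have \<omega>: "\<omega> \<in> space M" "N k \<omega> = j" by auto
    have N: "N k \<omega> = (LEAST j. ?stop j \<omega>)"
      using run[OF \<omega>(1)] by (simp add: retro_run_def)
    have "?stop j \<omega>"
      using LeastI_ex[OF stop[OF \<omega>(1)]] N \<omega>(2) by simp
    moreover have "\<not> ?stop i \<omega>" if "i < j" for i
      using that N \<omega>(2) not_less_Least[of i "\<lambda>j. ?stop j \<omega>"] by simp
    ultimately show "\<omega> \<in> S j \<inter> (\<Inter>i\<in>{..<j}. X i - S i) \<inter> space ?H"
      using \<omega> dom[OF \<omega>(1)] by (auto simp: X_def S_def)
  next
    fix \<omega> assume \<omega>: "\<omega> \<in> S j \<inter> (\<Inter>i\<in>{..<j}. X i - S i) \<inter> space ?H"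
    then have \<omega>M: "\<omega> \<in> space M" and j: "?stop j \<omega>" by (auto simp: S_def)
    have before: "\<not> ?stop i \<omega>" if "i < j" for i
      using \<omega> that by (auto simp: X_def S_def)
    have "(LEAST j. ?stop j \<omega>) = j"
      using j
    proof (rule Least_equality)
      fix i assume "?stop i \<omega>"
      with before[of i] show "j \<le> i"
        by (cases "i < j") simp_all
    qed
    then show "\<omega> \<in> N k -` {j} \<inter> space ?H"
      using run[OF \<omega>M] \<omega>M by (simp add: retro_run_def)
  qed
  moreover have "S j \<inter> (\<Inter>i\<in>{..<j}. X i - S i) \<inter> space ?H \<in> sets ?H" for j
  proof -
    have "S j \<inter> (\<Inter>i\<in>{..<j}. X i - S i) \<inter> space ?H
        = S j \<inter> {\<omega> \<in> space ?H. \<forall>i\<in>{..<j}. \<omega> \<in> X i - S i}"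
      by auto
    also have "\<dots> \<in> sets ?H"
      using X S by measurable
    finally show ?thesis .
  qed
  ultimately show ?thesis
    by (simp add: measurable_count_space_eq2_countable)
qed

lemma
  assumes x: "x k 0 \<in> borel_measurable (hist k)"
  shows measurable_x_end: "(\<lambda>\<omega>. x k (N k \<omega>) \<omega>) \<in> borel_measurable (hist (Suc k))"
    and measurable_lam_end: "(\<lambda>\<omega>. lam k (N k \<omega>) \<omega>) \<in> borel_measurable (hist (Suc k))"
  using measurable_inner_iterates[OF x]
  by (auto intro: measurable_compose_countable[OF _ measurable_N[OF x]])

lemma x_start: "\<omega> \<in> space M \<Longrightarrow> x k 0 \<omega> = outer_prev (x0 \<omega>) (\<lambda>k j. x k j \<omega>) (\<lambda>k. N k \<omega>) k"
  using run by (simp add: retro_run_def)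

text \<open>Closes the circle: a measurable starting point gives measurable inner iterates and a
  measurable \<open>N k\<close>, hence a measurable final iterate, which is the next starting
  point.\<close>

lemma measurable_x_start: "x k 0 \<in> borel_measurable (hist k)"
proof (induction k)
  case 0
  show ?case
    by (rule measurable_cong[THEN iffD2, OF _ measurable_x0_hist]) (simp add: x_start outer_prev_def)
next
  case (Suc k)
  show ?case
    by (rule measurable_cong[THEN iffD2, OF _ measurable_x_end[OF Suc]])
      (simp add: x_start[of _ "Suc k"] outer_prev_def)
qed

lemma measurable_lam_prev: "lam_prev k \<in> borel_measurable (hist k)"
proof (cases k)
  case 0
  then show ?thesis
    using measurable_l0_hist by (simp add: outer_prev_def)
next
  case (Suc i)
  then show ?thesis
    using measurable_lam_end[OF measurable_x_start, of i] by (simp add: outer_prev_def)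
qed

lemma measurable_start_dom: "x k 0 \<in> measurable (hist k) dom_borel"
  using dom by (intro measurable_dom measurable_x_start) auto

lemma measurable_start_dom': "x k 0 \<in> measurable (hist (Suc k)) dom_borel"
  by (rule measurable_hist_mono[OF measurable_start_dom]) simp

lemma measurable_end_dom: "(\<lambda>\<omega>. x k (N k \<omega>) \<omega>) \<in> measurable (hist (Suc k)) dom_borel"
  using dom by (intro measurable_dom measurable_x_end measurable_x_start) auto

lemma measurable_T_start: "T_start k \<in> borel_measurable (hist k)"
  by (intro measurable_norm_residual measurable_lam_prev measurable_start_dom
      measurable_compose[OF measurable_start_dom measurable_gf])

lemma measurable_T_end: "T_end k \<in> borel_measurable (hist (Suc k))"
  by (intro measurable_norm_residual measurable_lam_end measurable_x_start measurable_end_dom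
      measurable_compose[OF measurable_end_dom measurable_gf])

lemma T_start_Suc: "\<omega> \<in> space M \<Longrightarrow> T_start (Suc k) \<omega> = T_end k \<omega>"
  by (simp add: x_start[of _ "Suc k"] outer_prev_def)

section \<open>Conditional size of the sampling errors\<close>

lemma measurable_err:
  assumes "Y \<in> measurable (hist (Suc k)) dom_borel"
  shows "(\<lambda>\<omega>. err k \<omega> (Y \<omega>)) \<in> borel_measurable (hist (Suc k))"
  by (intro borel_measurable_norm[THEN measurable_compose[rotated]] borel_measurable_diff
      measurable_compose[OF assms measurable_gf] measurable_batch_grad assms measurable_ident_sets refl)

text \<open>The variance at a fixed point, a deterministic function. The conditional variance of the
  algorithm turns out to be this function evaluated at \<open>x k 0\<close>.\<close>

definition grad_var :: "real ^ 'n \<Rightarrow> ennreal" where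
  "grad_var y = (\<integral>\<^sup>+ \<zeta>. ennreal ((norm (gf y - gF y \<zeta>))\<^sup>2) \<partial>P)"

lemma measurable_gF_at: "y \<in> \<X> \<Longrightarrow> gF y \<in> borel_measurable P"
  using expectation by (auto simp: expectation_problem_def)

lemma measurable_grad_var [measurable]: "grad_var \<in> borel_measurable dom_borel"
proof -
  note [measurable] = measurable_gF
  have "(\<lambda>(y, \<zeta>). ennreal ((norm (gf y - gF y \<zeta>))\<^sup>2)) \<in> borel_measurable (dom_borel \<Otimes>\<^sub>M P)"
    by measurable
  then show ?thesis
    unfolding grad_var_def by (rule P.borel_measurable_nn_integral)
qed

text \<open>The error is the average of \<open>q\<close> independent centred vectors: their sum has
  second moment \<open>q\<close> times the variance, and averaging divides by the square of
  \<open>q\<close>.\<close>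

lemma nn_integral_batch_error:
  assumes y: "y \<in> \<X>" and fin: "grad_var y < \<top>" and q: "1 \<le> q"
  shows "(\<integral>\<^sup>+ s. ennreal ((norm (gf y - sample_grad gF (draws q s) y))\<^sup>2) \<partial>Pi\<^sub>M {..<q} (\<lambda>_. P))
    = ennreal (enn2real (grad_var y) / real q)"
proof -
  have int: "integrable P (gF y)" and gf: "gf y = (\<integral>\<zeta>. gF y \<zeta> \<partial>P)"
    using expectation y by (auto simp: expectation_problem_def)
  have [measurable]: "gF y \<in> borel_measurable P"
    by (rule measurable_gF_at[OF y])
  define u where "u \<zeta> = gf y - gF y \<zeta>" for \<zeta>
  have u: "integrable P u" "(\<integral>\<zeta>. u \<zeta> \<partial>P) = 0"
    unfolding u_def using int by (auto simp: P.prob_space simp flip: gf)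
  have [measurable]: "u \<in> borel_measurable P"
    unfolding u_def by measurable
  have sq: "integrable P (\<lambda>\<zeta>. (norm (u \<zeta>))\<^sup>2)"
    using fin by (intro integrableI_bounded) (auto simp: grad_var_def u_def)
  have eq: "(norm (gf y - sample_grad gF (draws q s) y))\<^sup>2
      = (1 / real q)\<^sup>2 * (norm (\<Sum>i\<in>{..<q}. u (s i)))\<^sup>2" for s
  proof -
    have "gf y - sample_grad gF (draws q s) y = (1 / real q) *\<^sub>R (\<Sum>i\<in>{..<q}. u (s i))"
      using q by (simp add: sample_grad_draws u_def sum_subtractf scaleR_diff_right sum_constant_scaleR
          del: sum_constant)
    then show ?thesis
      by (simp add: power_mult_distrib power_divide)
  qed
  have "(\<integral>\<^sup>+ s. ennreal ((norm (gf y - sample_grad gF (draws q s) y))\<^sup>2) \<partial>Pi\<^sub>M {..<q} (\<lambda>_. P))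
      = ennreal ((1 / real q)\<^sup>2) * (\<integral>\<^sup>+ s. ennreal ((norm (\<Sum>i\<in>{..<q}. u (s i)))\<^sup>2) \<partial>Pi\<^sub>M {..<q} (\<lambda>_. P))"
    unfolding eq by (subst nn_integral_cmult[symmetric]) (auto simp: ennreal_mult)
  also have "\<dots> = ennreal ((1 / real q)\<^sup>2) * (ennreal (real q) * ennreal (enn2real (grad_var y)))"
    using nn_integral_norm_sum_iid[OF P.prob_space_axioms u sq, of "{..<q}"] fin
    by (simp add: grad_var_def u_def ennreal_of_nat_eq_real_of_nat)
  also have "\<dots> = ennreal ((1 / real q)\<^sup>2 * (real q * enn2real (grad_var y)))"
    by (simp add: ennreal_mult)
  also have "(1 / real q)\<^sup>2 * (real q * enn2real (grad_var y)) = enn2real (grad_var y) / real q"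
    using q by (simp add: power2_eq_square)
  finally show ?thesis .
qed

lemma cond_grad_var_eq:
  "AE \<omega> in M. cond_grad_var M (hist k) gf gF (x k 0) (\<xi> k 0) \<omega> = grad_var (x k 0 \<omega>)"
proof -
  interpret sigma_finite_subalgebra M "hist k"
    by (rule sigma_finite_subalgebra_hist)
  \<comment> \<open>The sample \<open>\<xi> k 0\<close> is read as the first entry of the batch,
    which brings it under the freezing principle. A batch of size zero has no such entry; the value
    \<open>0\<close> there is a default that never occurs, as \<open>n k\<close> is at least
    one.\<close>
  define h where "h q s y = (if q = 0 then 0 else ennreal ((norm (gF y (s 0) - gf y))\<^sup>2))"
    for q :: nat and s :: "nat \<Rightarrow> 's" and y
  have h: "(\<lambda>(s, y). h q s y) \<in> borel_measurable (Pi\<^sub>M {..<q} (\<lambda>_. P) \<Otimes>\<^sub>M dom_borel)" for q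
  proof (cases "q = 0")
    case False
    have [measurable]: "(\<lambda>p. gF (snd p) (fst p 0)) \<in> borel_measurable (Pi\<^sub>M {..<q} (\<lambda>_. P) \<Otimes>\<^sub>M dom_borel)"
      using False by (intro measurable_gF_compose) auto
    show ?thesis
      unfolding h_def case_prod_beta using False by simp
  qed (simp add: h_def)
  have xM [measurable]: "x k 0 \<in> measurable M dom_borel"
    by (rule measurable_from_subalg[OF subalgebra_hist measurable_start_dom])
  have [measurable]: "(\<lambda>\<omega>. gF (x k 0 \<omega>) (\<xi> k 0 \<omega>)) \<in> borel_measurable M"
    by (rule measurable_gF_compose) auto
  have hM: "(\<lambda>\<omega>. h (n k \<omega>) (samples k \<omega>) (x k 0 \<omega>)) \<in> borel_measurable M"
    by (rule measurable_from_subalg[OF subalgebra_hist],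
        rule measurable_samples[OF measurable_ident_sets[OF refl] measurable_start_dom' h])
  have "AE \<omega> in M. cond_grad_var M (hist k) gf gF (x k 0) (\<xi> k 0) \<omega>
      = nn_cond_exp M (hist k) (\<lambda>\<omega>. h (n k \<omega>) (samples k \<omega>) (x k 0 \<omega>)) \<omega>"
    unfolding cond_grad_var_def
  proof (rule nn_cond_exp_cong[OF _ _ hM])
    show "AE \<omega> in M. ennreal ((norm (gF (x k 0 \<omega>) (\<xi> k 0 \<omega>) - gf (x k 0 \<omega>)))\<^sup>2)
        = h (n k \<omega>) (samples k \<omega>) (x k 0 \<omega>)"
    proof (rule AE_I2)
      fix \<omega> assume "\<omega> \<in> space M"
      then show "ennreal ((norm (gF (x k 0 \<omega>) (\<xi> k 0 \<omega>) - gf (x k 0 \<omega>)))\<^sup>2)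
          = h (n k \<omega>) (samples k \<omega>) (x k 0 \<omega>)"
        using n_pos[of \<omega> k] by (auto simp: h_def)
    qed
  qed measurable
  moreover note nn_cond_exp_samples[OF measurable_start_dom h, of k]
  ultimately show ?thesis
    using AE_space
  proof eventually_elim
    case (elim \<omega>)
    let ?q = "n k \<omega>" and ?y = "x k 0 \<omega>"
    have q: "0 < ?q" using n_pos[OF elim(3), of k] by simp
    have y: "?y \<in> \<X>" using dom[OF elim(3)] by simp
    note [measurable] = measurable_gF_at[OF y]
    have "(\<integral>\<^sup>+ s. h ?q s ?y \<partial>Pi\<^sub>M {..<?q} (\<lambda>_. P))
        = (\<integral>\<^sup>+ \<zeta>. ennreal ((norm (gF ?y \<zeta> - gf ?y))\<^sup>2) \<partial>distr (Pi\<^sub>M {..<?q} (\<lambda>_. P)) P (\<lambda>s. s 0))"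
      using q by (subst nn_integral_distr) (auto simp: h_def)
    \<comment> \<open>One coordinate of the product has law \<open>P\<close>, so the batch size
      disappears from the conditional variance.\<close>
    also have "distr (Pi\<^sub>M {..<?q} (\<lambda>_. P)) P (\<lambda>s. s 0) = P"
      using q by (intro distr_PiM_component P.prob_space_axioms) auto
    finally show ?case
      using elim by (simp add: grad_var_def norm_minus_commute)
  qed
qed

lemma nn_cond_exp_start_error:
  assumes fin: "\<And>y. y \<in> \<X> \<Longrightarrow> grad_var y < \<top>"
  shows "AE \<omega> in M. nn_cond_exp M (hist k) (\<lambda>\<omega>. ennreal ((err k \<omega> (x k 0 \<omega>))\<^sup>2)) \<omega>
    = ennreal (enn2real (grad_var (x k 0 \<omega>)) / real (n k \<omega>))"
proof -
  define h where "h q s y = ennreal ((norm (gf y - sample_grad gF (draws q s) y))\<^sup>2)"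
    for q :: nat and s :: "nat \<Rightarrow> 's" and y
  have h: "(\<lambda>(s, y). h q s y) \<in> borel_measurable (Pi\<^sub>M {..<q} (\<lambda>_. P) \<Otimes>\<^sub>M dom_borel)" for q
  proof -
    note [measurable] = measurable_sample_grad[of q, unfolded case_prod_beta]
    show ?thesis
      unfolding h_def case_prod_beta by measurable
  qed
  have "draws (n k \<omega>) (samples k \<omega>) = batch k \<omega>" for \<omega>
    by (rule draws_cong) simp
  then have "h (n k \<omega>) (samples k \<omega>) (x k 0 \<omega>) = ennreal ((err k \<omega> (x k 0 \<omega>))\<^sup>2)" for \<omega>
    by (simp add: h_def)
  with nn_cond_exp_samples[OF measurable_start_dom h, of k]
  have "AE \<omega> in M. nn_cond_exp M (hist k) (\<lambda>\<omega>. ennreal ((err k \<omega> (x k 0 \<omega>))\<^sup>2)) \<omega>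
      = (\<integral>\<^sup>+ s. h (n k \<omega>) s (x k 0 \<omega>) \<partial>Pi\<^sub>M {..<n k \<omega>} (\<lambda>_. P))"
    by simp
  then show ?thesis
    using AE_space
  proof eventually_elim
    case (elim \<omega>)
    then show ?case
      using nn_integral_batch_error[OF _ fin n_pos] dom[OF elim(2)] by (simp add: h_def)
  qed
qed

text \<open>The ratio is a supremum over all of \<open>\<X>\<close> and thus a function of the batch
  alone. The freezing principle therefore applies with a dummy history variable, for which
  \<open>x0\<close> serves.\<close>

lemma
  assumes meas: "\<And>q. 1 \<le> q \<Longrightarrow>
      (\<lambda>s. grad_error_ratio \<X> gf gF \<epsilon>G (draws q s)) \<in> borel_measurable (Pi\<^sub>M {..<q} (\<lambda>_. P))"
    and bound: "\<And>q. 1 \<le> q \<Longrightarrow>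
      (\<integral>\<^sup>+ s. (grad_error_ratio \<X> gf gF \<epsilon>G (draws q s))\<^sup>2 \<partial>Pi\<^sub>M {..<q} (\<lambda>_. P)) \<le> ennreal (\<kappa>G\<^sup>2 / real q)"
  shows measurable_error_ratio:
      "(\<lambda>\<omega>. grad_error_ratio \<X> gf gF \<epsilon>G (batch k \<omega>)) \<in> borel_measurable M"
    and nn_cond_exp_error_ratio:
      "AE \<omega> in M. nn_cond_exp M (hist k) (\<lambda>\<omega>. (grad_error_ratio \<X> gf gF \<epsilon>G (batch k \<omega>))\<^sup>2) \<omega>
        \<le> ennreal (\<kappa>G\<^sup>2 / real (n k \<omega>))"
proof -
  let ?G = "grad_error_ratio \<X> gf gF \<epsilon>G"
  \<comment> \<open>The assumptions concern sizes \<open>q \<ge> 1\<close>, while the freezing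
    principle asks for measurability at every size; for size zero the function is constant.\<close>
  have G0: "(\<lambda>s. ?G (draws 0 s)) = (\<lambda>s. ?G (draws 0 undefined))"
    by (rule ext, rule arg_cong[of _ _ ?G], rule draws_cong) simp
  have meas': "(\<lambda>s. ?G (draws q s)) \<in> borel_measurable (Pi\<^sub>M {..<q} (\<lambda>_. P))" for q
    by (cases "q = 0") (use meas[of q] G0 in auto)
  have h: "(\<lambda>(s, y :: real ^ 'n). ?G (draws q s)) \<in> borel_measurable (Pi\<^sub>M {..<q} (\<lambda>_. P) \<Otimes>\<^sub>M borel)" for q
    unfolding case_prod_beta by (rule measurable_compose[OF measurable_fst meas'])
  then have h2: "(\<lambda>(s, y :: real ^ 'n). (?G (draws q s))\<^sup>2) \<in> borel_measurable (Pi\<^sub>M {..<q} (\<lambda>_. P) \<Otimes>\<^sub>M borel)" for q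
    unfolding case_prod_beta by measurable
  have b: "draws (n k \<omega>) (samples k \<omega>) = batch k \<omega>" for \<omega>
    by (rule draws_cong) simp
  from measurable_samples[OF measurable_ident_sets[OF refl] measurable_x0_hist h, of k]
  show "(\<lambda>\<omega>. ?G (batch k \<omega>)) \<in> borel_measurable M"
    unfolding b by (rule measurable_from_subalg[OF subalgebra_hist])
  from nn_cond_exp_samples[OF measurable_x0_hist h2, of k] AE_space
  show "AE \<omega> in M. nn_cond_exp M (hist k) (\<lambda>\<omega>. (?G (batch k \<omega>))\<^sup>2) \<omega> \<le> ennreal (\<kappa>G\<^sup>2 / real (n k \<omega>))"
    unfolding b
  proof eventually_elim
    case (elim \<omega>)
    then show ?case using bound[OF n_pos[OF elim(2)]] by simp
  qed
qed

text \<open>The product is split in two so that Cauchy-Schwarz can pair the ratio once with the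
  constant and once with the gradient norm; this yields the sum of \<open>\<epsilon>G\<close> and
  \<open>\<kappa>g\<close> in the final constant.\<close>

lemma final_error_le:
  assumes "\<omega> \<in> space M" "0 < \<epsilon>G"
  shows "ennreal (err k \<omega> (x k (N k \<omega>) \<omega>))
    \<le> grad_error_ratio \<X> gf gF \<epsilon>G (batch k \<omega>) * ennreal \<epsilon>G
      + grad_error_ratio \<X> gf gF \<epsilon>G (batch k \<omega>) * ennreal (norm (gf (x k (N k \<omega>) \<omega>)))"
proof -
  let ?y = "x k (N k \<omega>) \<omega>" and ?G = "grad_error_ratio \<X> gf gF \<epsilon>G (batch k \<omega>)"
  have pos: "0 < \<epsilon>G + norm (gf ?y)"
    using assms(2) by (simp add: add_pos_nonneg)
  have "ennreal (err k \<omega> ?y / (\<epsilon>G + norm (gf ?y))) \<le> ?G"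
    unfolding grad_error_ratio_def using dom[OF assms(1)] by (intro SUP_upper) auto
  then have "ennreal (err k \<omega> ?y / (\<epsilon>G + norm (gf ?y))) * ennreal (\<epsilon>G + norm (gf ?y))
      \<le> ?G * ennreal (\<epsilon>G + norm (gf ?y))"
    by (intro mult_right_mono) auto
  also have "\<dots> = ?G * ennreal \<epsilon>G + ?G * ennreal (norm (gf ?y))"
    using assms(2) by (simp add: ennreal_plus distrib_left)
  also have "ennreal (err k \<omega> ?y / (\<epsilon>G + norm (gf ?y))) * ennreal (\<epsilon>G + norm (gf ?y)) = ennreal (err k \<omega> ?y)"
    using pos by (simp flip: ennreal_mult')
  finally show ?thesis .
qed

text \<open>All conditional means are compared with one quantity, the root mean square error
  \<open>s\<close> at the start. The batch-size condition bounds \<open>s\<close>, the tolerance is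
  a multiple of it, and the variance bound compares the size of the error ratio with it, which is
  where division by \<open>\<kappa>\<sigma>\<close> comes from.\<close>

lemma nn_cond_exp_T_end:
  assumes nonneg: "0 < \<epsilon>G" "0 \<le> \<kappa>g" "0 \<le> \<kappa>G" "0 < \<kappa>\<sigma>" "0 \<le> \<theta>" "0 \<le> a" "0 < \<beta>" "0 \<le> \<omega>'"
    and fin: "\<And>y. y \<in> \<X> \<Longrightarrow> grad_var y < \<top>"
    and final_grad: "AE \<omega> in M. nn_cond_exp M (hist k) (\<lambda>\<omega>. ennreal ((norm (gf (x k (N k \<omega>) \<omega>)))\<^sup>2)) \<omega>
        \<le> ennreal (\<kappa>g\<^sup>2)"
    and ratio: "\<And>q. 1 \<le> q \<Longrightarrow>
      (\<lambda>s. grad_error_ratio \<X> gf gF \<epsilon>G (draws q s)) \<in> borel_measurable (Pi\<^sub>M {..<q} (\<lambda>_. P))"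
      "\<And>q. 1 \<le> q \<Longrightarrow>
      (\<integral>\<^sup>+ s. (grad_error_ratio \<X> gf gF \<epsilon>G (draws q s))\<^sup>2 \<partial>Pi\<^sub>M {..<q} (\<lambda>_. P)) \<le> ennreal (\<kappa>G\<^sup>2 / real q)"
    and var: "AE \<omega> in M. cond_grad_var M (hist k) gf gF (x k 0) (\<xi> k 0) \<omega> \<ge> ennreal (\<kappa>G\<^sup>2 * \<kappa>\<sigma>\<^sup>2)"
    and start: "AE \<omega> in M. nn_cond_exp M (hist k) (\<lambda>\<omega>. ennreal ((err k \<omega> (x k 0 \<omega>))\<^sup>2)) \<omega>
        \<le> ennreal (\<theta>\<^sup>2 * (T_start k \<omega>)\<^sup>2 + a\<^sup>2 * \<beta> ^ (2 * k))"
    and \<gamma>: "0 \<le> \<gamma> k" "\<gamma> k \<le> \<gamma>'"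
    and \<epsilon>: "AE \<omega> in M. \<epsilon> k \<omega>
        = \<omega>' * sqrt (enn2real (cond_grad_var M (hist k) gf gF (x k 0) (\<xi> k 0) \<omega>) / real (n k \<omega>))"
    and \<phi>: "\<phi> = (\<epsilon>G + \<kappa>g) / \<kappa>\<sigma>"
  shows "AE \<omega> in M. nn_cond_exp M (hist k) (\<lambda>\<omega>. ennreal (T_end k \<omega>)) \<omega>
    \<le> ennreal ((\<gamma>' + \<theta> * (\<omega>' + \<phi> + \<gamma>')) * T_start k \<omega> + a * (\<omega>' + \<phi> + \<gamma>') * \<beta> ^ k)"
proof -
  interpret sigma_finite_subalgebra M "hist k"
    by (rule sigma_finite_subalgebra_hist)
  let ?E = "nn_cond_exp M (hist k)"
  define e where "e \<omega> = err k \<omega> (x k 0 \<omega>)" for \<omega>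
  define g where "g \<omega> = norm (gf (x k (N k \<omega>) \<omega>))" for \<omega>
  define G where "G \<omega> = grad_error_ratio \<X> gf gF \<epsilon>G (batch k \<omega>)" for \<omega>
  define s where "s \<omega> = sqrt (enn2real (grad_var (x k 0 \<omega>)) / real (n k \<omega>))" for \<omega>
  define p where "p \<omega> = \<kappa>G / sqrt (real (n k \<omega>))" for \<omega>
  have fromH: "h \<in> borel_measurable M" if "h \<in> borel_measurable (hist (Suc k))" for h :: "'w \<Rightarrow> real"
    by (rule measurable_from_subalg[OF subalgebra_hist that])
  have [measurable]: "e \<in> borel_measurable M"
    unfolding e_def by (intro fromH measurable_err measurable_start_dom')
  have [measurable]: "g \<in> borel_measurable M"
    unfolding g_def
    by (intro fromH borel_measurable_norm[THEN measurable_compose[rotated]]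
        measurable_compose[OF measurable_end_dom measurable_gf])
  have [measurable]: "T_end k \<in> borel_measurable M"
    by (intro fromH measurable_T_end)
  have [measurable]: "G \<in> borel_measurable M"
    unfolding G_def by (rule measurable_error_ratio[OF ratio])
  note [measurable] = measurable_n_hist measurable_T_start
  have [measurable]: "(\<lambda>\<omega>. grad_var (x k 0 \<omega>)) \<in> borel_measurable (hist k)"
    by (rule measurable_compose[OF measurable_start_dom measurable_grad_var])
  have [measurable]: "s \<in> borel_measurable (hist k)" "p \<in> borel_measurable (hist k)"
    unfolding s_def p_def by measurable
  have [measurable]: "\<epsilon> k \<in> borel_measurable (hist k)"
    using choices by (simp add: measurable_choices_def)
  have nn: "0 \<le> s \<omega>" "0 \<le> p \<omega>" "0 \<le> e \<omega>" "0 \<le> g \<omega>" for \<omega>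
    using nonneg by (auto simp: s_def p_def e_def g_def)
  have const: "AE \<omega> in M. ?E (\<lambda>\<omega>. (ennreal r)\<^sup>2) \<omega> \<le> ennreal (r\<^sup>2)" if "0 \<le> r" for r
    using that by (intro nn_cond_exp_F_meas_le) (auto simp: ennreal_power)
  have e_sq: "AE \<omega> in M. ?E (\<lambda>\<omega>. (ennreal (e \<omega>))\<^sup>2) \<omega> = ennreal ((s \<omega>)\<^sup>2)"
    using nn_cond_exp_start_error[OF fin, of k] nn by (simp add: ennreal_power s_def flip: e_def)
  then have "AE \<omega> in M. ?E (\<lambda>\<omega>. (ennreal (e \<omega>))\<^sup>2) \<omega> \<le> ennreal ((s \<omega>)\<^sup>2)"
    by eventually_elim simp
  \<comment> \<open>Cauchy-Schwarz against the constant one plays the role of Jensen's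
    inequality.\<close>
  then have e_le: "AE \<omega> in M. ?E (\<lambda>\<omega>. ennreal (e \<omega>)) \<omega> \<le> ennreal (s \<omega>)"
    using nn_cond_exp_Cauchy_Schwarz[of "\<lambda>\<omega>. ennreal (e \<omega>)" "\<lambda>_. ennreal 1" s "\<lambda>_. 1"] nn const[of 1]
    by simp
  have G_sq: "AE \<omega> in M. ?E (\<lambda>\<omega>. (G \<omega>)\<^sup>2) \<omega> \<le> ennreal ((p \<omega>)\<^sup>2)"
    using nn_cond_exp_error_ratio[OF ratio, of k] by (simp add: p_def power_divide flip: G_def)
  have G_eps: "AE \<omega> in M. ?E (\<lambda>\<omega>. G \<omega> * ennreal \<epsilon>G) \<omega> \<le> ennreal (p \<omega> * \<epsilon>G)"
    using nonneg by (intro nn_cond_exp_Cauchy_Schwarz nn G_sq const) auto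
  have G_g: "AE \<omega> in M. ?E (\<lambda>\<omega>. G \<omega> * ennreal (g \<omega>)) \<omega> \<le> ennreal (p \<omega> * \<kappa>g)"
  proof (intro nn_cond_exp_Cauchy_Schwarz nn G_sq)
    show "AE \<omega> in M. ?E (\<lambda>\<omega>. (ennreal (g \<omega>))\<^sup>2) \<omega> \<le> ennreal (\<kappa>g\<^sup>2)"
      using final_grad nn by (simp add: ennreal_power flip: g_def)
  qed (use nonneg in auto)
  \<comment> \<open>The part known from the history. The absolute value makes \<open>B\<close>
    nonnegative at every point, also outside \<open>space M\<close>; almost everywhere it has no
    effect, because the tolerance is then a nonnegative multiple of \<open>s\<close>.\<close>
  define B where "B \<omega> = \<gamma> k * T_start k \<omega> + \<bar>\<epsilon> k \<omega>\<bar>" for \<omega>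
  have [measurable]: "B \<in> borel_measurable (hist k)"
    unfolding B_def by measurable
  then have [measurable]: "B \<in> borel_measurable M"
    by (rule measurable_from_subalg[OF subalgebra_hist])
  have B: "0 \<le> B \<omega>" for \<omega>
    using \<gamma> by (simp add: B_def)
  have B_le: "AE \<omega> in M. ?E (\<lambda>\<omega>. ennreal (B \<omega>)) \<omega> \<le> ennreal (B \<omega>)"
    by (intro nn_cond_exp_F_meas_le) auto
  have "AE \<omega> in M. ?E (\<lambda>\<omega>. ennreal (T_end k \<omega>)) \<omega>
      \<le> ?E (\<lambda>\<omega>. (ennreal (B \<omega>) + ennreal (\<gamma> k) * ennreal (e \<omega>)) + (G \<omega> * ennreal \<epsilon>G + G \<omega> * ennreal (g \<omega>))) \<omega>"
  proof (rule nn_cond_exp_mono[OF AE_I2])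
    fix \<omega> assume \<omega>: "\<omega> \<in> space M"
    have "rank (J (x k 0 \<omega>)) = CARD('m)"
      using problem dom[OF \<omega>] by (auto simp: smooth_problem_def)
    from outer_loop_bound[OF run[OF \<omega>] stop[OF \<omega>] this, of gf]
    have "T_end k \<omega> \<le> (B \<omega> + \<gamma> k * e \<omega>) + err k \<omega> (x k (N k \<omega>) \<omega>)"
      by (simp add: B_def e_def algebra_simps)
    then have "ennreal (T_end k \<omega>) \<le> ennreal ((B \<omega> + \<gamma> k * e \<omega>) + err k \<omega> (x k (N k \<omega>) \<omega>))"
      by (rule ennreal_leI)
    also have "\<dots> = (ennreal (B \<omega>) + ennreal (\<gamma> k) * ennreal (e \<omega>)) + ennreal (err k \<omega> (x k (N k \<omega>) \<omega>))"
      using B nn \<gamma> by (simp add: ennreal_plus ennreal_mult)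
    also have "\<dots> \<le> (ennreal (B \<omega>) + ennreal (\<gamma> k) * ennreal (e \<omega>)) + (G \<omega> * ennreal \<epsilon>G + G \<omega> * ennreal (g \<omega>))"
      unfolding G_def g_def using \<omega> nonneg by (intro add_left_mono final_error_le)
    finally show "ennreal (T_end k \<omega>)
        \<le> (ennreal (B \<omega>) + ennreal (\<gamma> k) * ennreal (e \<omega>)) + (G \<omega> * ennreal \<epsilon>G + G \<omega> * ennreal (g \<omega>))" .
  qed measurable
  moreover have "AE \<omega> in M.
      ?E (\<lambda>\<omega>. (ennreal (B \<omega>) + ennreal (\<gamma> k) * ennreal (e \<omega>)) + (G \<omega> * ennreal \<epsilon>G + G \<omega> * ennreal (g \<omega>))) \<omega>
      \<le> ennreal ((B \<omega> + \<gamma> k * s \<omega>) + (p \<omega> * \<epsilon>G + p \<omega> * \<kappa>g))"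
    using nonneg \<gamma> nn B
    by (intro nn_cond_exp_add_le nn_cond_exp_cmult_le B_le e_le G_eps G_g) auto
  ultimately show ?thesis
    using cond_grad_var_eq[of k] var \<epsilon> start e_sq AE_space
  proof eventually_elim
    case (elim \<omega>)
    define v where "v = enn2real (grad_var (x k 0 \<omega>))"
    define t where "t = \<theta> * T_start k \<omega> + a * \<beta> ^ k"
    have x: "x k 0 \<omega> \<in> \<X>" using dom[OF elim(8)] by simp
    have v: "grad_var (x k 0 \<omega>) = ennreal v" "0 \<le> v"
      using fin[OF x] by (auto simp: v_def)
    have n: "0 < real (n k \<omega>)" using n_pos[OF elim(8), of k] by simp
    have s: "s \<omega> = sqrt v / sqrt (real (n k \<omega>))"
      by (simp add: s_def v_def real_sqrt_divide)
    have "ennreal ((s \<omega>)\<^sup>2) \<le> ennreal (\<theta>\<^sup>2 * (T_start k \<omega>)\<^sup>2 + a\<^sup>2 * \<beta> ^ (2 * k))"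
      using elim(6,7) nn by (simp add: ennreal_power flip: e_def)
    then have "(s \<omega>)\<^sup>2 \<le> \<theta>\<^sup>2 * (T_start k \<omega>)\<^sup>2 + a\<^sup>2 * \<beta> ^ (2 * k)"
      using nonneg by (subst (asm) ennreal_le_iff) auto
    then have "s \<omega> \<le> sqrt (\<theta>\<^sup>2 * (T_start k \<omega>)\<^sup>2 + a\<^sup>2 * \<beta> ^ (2 * k))"
      by (rule real_le_rsqrt)
    also have "\<dots> \<le> t"
      unfolding t_def using nonneg by (intro sqrt_sum_squares_geometric_le) auto
    finally have st: "s \<omega> \<le> t" .
    have \<epsilon>: "\<epsilon> k \<omega> = \<omega>' * s \<omega>"
      using elim(3,5) by (simp add: s_def)
    have "ennreal ((\<kappa>G * \<kappa>\<sigma>)\<^sup>2) \<le> ennreal v"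
      using elim(3,4) v by (simp add: power_mult_distrib)
    then have "(\<kappa>G * \<kappa>\<sigma>)\<^sup>2 \<le> v"
      using v(2) by simp
    then have "\<kappa>G * \<kappa>\<sigma> \<le> sqrt v"
      by (rule real_le_rsqrt)
    \<comment> \<open>Both sides carry the same division by the square root of the batch size, so a
      bound between constants becomes a bound between errors, uniform in the batch size.\<close>
    then have "p \<omega> * \<kappa>\<sigma> \<le> s \<omega>"
      unfolding s p_def using n by (simp add: divide_right_mono)
    then have "p \<omega> \<le> t / \<kappa>\<sigma>"
      using st nonneg by (simp add: pos_le_divide_eq)
    then have "p \<omega> * (\<epsilon>G + \<kappa>g) \<le> t / \<kappa>\<sigma> * (\<epsilon>G + \<kappa>g)"
      using nonneg by (intro mult_right_mono) auto
    then have p: "p \<omega> * \<epsilon>G + p \<omega> * \<kappa>g \<le> \<phi> * t"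
      by (simp add: \<phi> algebra_simps)
    have "\<omega>' * s \<omega> \<le> \<omega>' * t"
      using nonneg st by (intro mult_left_mono)
    then have e: "\<epsilon> k \<omega> \<le> \<omega>' * t + 0" "0 \<le> \<epsilon> k \<omega>"
      using \<epsilon> nonneg nn by auto
    have "?E (\<lambda>\<omega>. ennreal (T_end k \<omega>)) \<omega> \<le> ennreal ((B \<omega> + \<gamma> k * s \<omega>) + (p \<omega> * \<epsilon>G + p \<omega> * \<kappa>g))"
      using elim(1,2) by (rule order_trans)
    also have "\<dots> \<le> ennreal ((\<gamma>' + \<theta> * (\<omega>' + \<phi> + \<gamma>')) * T_start k \<omega> + (a * \<beta> ^ k * (\<omega>' + \<phi> + \<gamma>') + 0))"
      using e st p \<gamma> nn unfolding t_def B_def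
      by (intro ennreal_leI outer_loop_recursion[of "\<gamma> k" \<gamma>' _ "s \<omega>" _ "\<epsilon> k \<omega>" "p \<omega> * \<epsilon>G + p \<omega> * \<kappa>g"])
        (auto simp: distrib_left)
    finally show ?case
      by (simp add: mult_ac)
  qed
qed

section \<open>Iterating the recursion by the tower property\<close>

lemma nn_cond_exp_T_start_Suc:
  "AE \<omega> in M. nn_cond_exp M (hist 0) (\<lambda>\<omega>. ennreal (T_start (Suc k) \<omega>)) \<omega>
    = nn_cond_exp M (hist 0) (\<lambda>\<omega>. ennreal (T_end k \<omega>)) \<omega>"
proof -
  interpret sigma_finite_subalgebra M "hist 0"
    by (rule sigma_finite_subalgebra_hist)
  have [measurable]: "T_start (Suc k) \<in> borel_measurable M" "T_end k \<in> borel_measurable M"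
    by (rule measurable_from_subalg[OF subalgebra_hist measurable_T_start],
        rule measurable_from_subalg[OF subalgebra_hist measurable_T_end])
  show ?thesis
    by (rule nn_cond_exp_cong) (auto simp: T_start_Suc)
qed

text \<open>The one-step bound holds given \<open>hist k\<close>; conditioning further on
  \<open>hist 0\<close> preserves it, since it is affine in \<open>T_start k\<close> with
  nonnegative coefficients. The initial data may be random, so the factor with
  \<open>T_start 0\<close> stays a function of \<omega> and the geometric step is taken
  pointwise.\<close>

lemma nn_cond_exp_initial_T_start:
  assumes nonneg: "0 \<le> a\<^sub>1" "0 \<le> a\<^sub>2" "0 < \<beta>" "0 < \<nu>"
    and step: "\<And>k. AE \<omega> in M. nn_cond_exp M (hist k) (\<lambda>\<omega>. ennreal (T_end k \<omega>)) \<omega>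
      \<le> ennreal (a\<^sub>1 * T_start k \<omega> + a\<^sub>2 * \<beta> ^ k)"
  shows "AE \<omega> in M. nn_cond_exp M (hist 0) (\<lambda>\<omega>. ennreal (T_start k \<omega>)) \<omega>
    \<le> ennreal (max (a\<^sub>1 + \<nu>) \<beta> ^ k * max (T_start 0 \<omega>) (a\<^sub>2 / \<nu>))"
proof (induction k)
  case 0
  interpret sigma_finite_subalgebra M "hist 0"
    by (rule sigma_finite_subalgebra_hist)
  have [measurable]: "T_start 0 \<in> borel_measurable (hist 0)"
    by (rule measurable_T_start)
  show ?case
    by (rule nn_cond_exp_F_meas_le) (auto intro: ennreal_leI)
next
  case (Suc k)
  interpret sigma_finite_subalgebra M "hist 0"
    by (rule sigma_finite_subalgebra_hist)
  let ?E = "nn_cond_exp M (hist 0)"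
  have [measurable]: "T_start k \<in> borel_measurable M" for k
    by (rule measurable_from_subalg[OF subalgebra_hist measurable_T_start])
  have [measurable]: "T_end k \<in> borel_measurable M"
    by (rule measurable_from_subalg[OF subalgebra_hist measurable_T_end])
  note nn_cond_exp_T_start_Suc[of k]
  moreover have "AE \<omega> in M. ?E (\<lambda>\<omega>. ennreal (T_end k \<omega>)) \<omega>
      = ?E (nn_cond_exp M (hist k) (\<lambda>\<omega>. ennreal (T_end k \<omega>))) \<omega>"
    by (rule nn_cond_exp_nested_subalg[OF subalgebra_hist subalgebra_hist_le]) auto
  moreover have "AE \<omega> in M. ?E (nn_cond_exp M (hist k) (\<lambda>\<omega>. ennreal (T_end k \<omega>))) \<omega>
      \<le> ?E (\<lambda>\<omega>. ennreal a\<^sub>1 * ennreal (T_start k \<omega>) + ennreal (a\<^sub>2 * \<beta> ^ k)) \<omega>"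
  proof (rule nn_cond_exp_mono)
    show "AE \<omega> in M. nn_cond_exp M (hist k) (\<lambda>\<omega>. ennreal (T_end k \<omega>)) \<omega>
        \<le> ennreal a\<^sub>1 * ennreal (T_start k \<omega>) + ennreal (a\<^sub>2 * \<beta> ^ k)"
      using step[of k] nonneg by (simp add: ennreal_plus ennreal_mult)
  qed measurable
  moreover have "AE \<omega> in M. ?E (\<lambda>\<omega>. ennreal a\<^sub>1 * ennreal (T_start k \<omega>) + ennreal (a\<^sub>2 * \<beta> ^ k)) \<omega>
      \<le> ennreal (a\<^sub>1 * (max (a\<^sub>1 + \<nu>) \<beta> ^ k * max (T_start 0 \<omega>) (a\<^sub>2 / \<nu>)) + a\<^sub>2 * \<beta> ^ k)"
  proof (rule nn_cond_exp_add_le)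
    show "AE \<omega> in M. ?E (\<lambda>_. ennreal (a\<^sub>2 * \<beta> ^ k)) \<omega> \<le> ennreal (a\<^sub>2 * \<beta> ^ k)"
      by (intro nn_cond_exp_F_meas_le) auto
    show "AE \<omega> in M. ?E (\<lambda>\<omega>. ennreal a\<^sub>1 * ennreal (T_start k \<omega>)) \<omega>
        \<le> ennreal (a\<^sub>1 * (max (a\<^sub>1 + \<nu>) \<beta> ^ k * max (T_start 0 \<omega>) (a\<^sub>2 / \<nu>)))"
      using nonneg Suc by (intro nn_cond_exp_cmult_le) auto
  qed (use nonneg in \<open>auto intro!: mult_nonneg_nonneg simp: le_max_iff_disj\<close>)
  ultimately show ?case
  proof eventually_elim
    case (elim \<omega>)
    let ?C = "max (T_start 0 \<omega>) (a\<^sub>2 / \<nu>)"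
    have "a\<^sub>1 * (max (a\<^sub>1 + \<nu>) \<beta> ^ k * ?C) + a\<^sub>2 * \<beta> ^ k \<le> max (a\<^sub>1 + \<nu>) \<beta> ^ Suc k * ?C"
      using nonneg by (intro geometric_recursion_step) (auto simp: le_max_iff_disj)
    from order_trans[OF order_trans[OF elim(3,4)] ennreal_leI[OF this]]
    show ?case
      unfolding elim(1,2) .
  qed
qed

end

theorem theorem2p5:
  fixes \<X> :: "(real ^ 'n) set"
    and f :: "real ^ 'n \<Rightarrow> real" and gf :: "real ^ 'n \<Rightarrow> real ^ 'n"
    and c :: "real ^ 'n \<Rightarrow> real ^ 'm" and J :: "real ^ 'n \<Rightarrow> real ^ 'n ^ 'm"
    and F :: "real ^ 'n \<Rightarrow> 's \<Rightarrow> real" and gF :: "real ^ 'n \<Rightarrow> 's \<Rightarrow> real ^ 'n"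
    and solver :: "nat \<Rightarrow> 's multiset \<Rightarrow> (real ^ 'n) \<times> (real ^ 'm) \<Rightarrow> nat \<Rightarrow> (real ^ 'n) \<times> (real ^ 'm)"
    and \<gamma> :: "nat \<Rightarrow> real"
  assumes problem: "smooth_problem \<X> f gf c J"
  shows
    "(\<forall>(D :: 's set) (S :: nat \<Rightarrow> 's set) (\<epsilon> :: nat \<Rightarrow> real) x\<^sub>0 l\<^sub>0 x lam N
       \<kappa>\<^sub>g \<omega>\<^sub>1 \<omega>\<^sub>2 \<theta> \<theta>' a \<beta> \<gamma>' \<omega> \<omega>' \<nu> a\<^sub>1 a\<^sub>2.
       finite_sum_problem \<X> D f F gF \<and>
       (\<forall>k. S k \<subseteq> D \<and> S k \<noteq> {}) \<and>
       retro_run gF c J solver (\<lambda>k. mset_set (S k)) \<gamma> \<epsilon> x\<^sub>0 l\<^sub>0 x lam N \<and>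
       (\<forall>k. \<exists>j. inner_stop gF c J (\<lambda>k. mset_set (S k)) \<gamma> \<epsilon> x lam k j) \<and>
       (\<forall>k. \<forall>j\<le>N k. x k j \<in> \<X>) \<and>
       0 \<le> \<kappa>\<^sub>g \<and> 0 \<le> \<omega>\<^sub>1 \<and> 0 \<le> \<omega>\<^sub>2 \<and>
       (\<forall>k. (norm (gf (x k (N k))))\<^sup>2 \<le> \<kappa>\<^sub>g\<^sup>2) \<and>
       (\<forall>y\<in>\<X>. \<forall>\<xi>\<in>D. (norm (gF y \<xi>))\<^sup>2 \<le> \<omega>\<^sub>1\<^sup>2 * (norm (gf y))\<^sup>2 + \<omega>\<^sub>2\<^sup>2) \<and>
       0 \<le> \<theta> \<and> 0 \<le> \<theta>' \<and> 0 \<le> a \<and> 0 < \<beta> \<and> \<beta> < 1 \<and>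
       (\<forall>k. (norm (gf (x k 0) - sample_grad gF (mset_set (S k)) (x k 0)))\<^sup>2
              \<le> \<theta>\<^sup>2 * (norm (kkt_residual gf c J (x k 0) (outer_prev l\<^sub>0 lam N k)))\<^sup>2
                 + a\<^sup>2 * \<beta> ^ (2 * k)) \<and>
       (\<forall>k. (norm (gf (x k (N k)) - sample_grad gF (mset_set (S k)) (x k (N k))))\<^sup>2
              \<le> \<theta>'\<^sup>2 * (\<theta>\<^sup>2 * (norm (kkt_residual gf c J (x k 0) (outer_prev l\<^sub>0 lam N k)))\<^sup>2
                          + a\<^sup>2 * \<beta> ^ (2 * k))) \<and>
       (\<forall>k. 0 \<le> \<gamma> k \<and> \<gamma> k \<le> \<gamma>') \<and> \<gamma>' < 1 \<and>
       0 \<le> \<omega> \<and> 0 \<le> \<omega>' \<and>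
       (\<forall>k. \<epsilon> k = \<omega> * norm (gf (x k 0) - sample_grad gF (mset_set (S k)) (x k 0)) + \<omega>' * \<beta> ^ k) \<and>
       a\<^sub>1 = \<gamma>' + \<theta> * (\<omega> + \<theta>' + \<gamma>') \<and> a\<^sub>1 < 1 \<and>
       a\<^sub>2 = a * (\<omega> + \<theta>' + \<gamma>') + \<omega>' \<and>
       0 < \<nu> \<and> a\<^sub>1 + \<nu> < 1
       \<longrightarrow> (\<forall>k. norm (kkt_residual gf c J (x k (N k)) (lam k (N k)))
                \<le> (max (a\<^sub>1 + \<nu>) \<beta>) ^ (k + 1)
                   * max (norm (kkt_residual gf c J x\<^sub>0 l\<^sub>0)) (a\<^sub>2 / \<nu>)))
     \<and>
     (\<forall>(P :: 's measure) (M :: 'w measure) (n :: nat \<Rightarrow> 'w \<Rightarrow> nat) (\<xi> :: nat \<Rightarrow> nat \<Rightarrow> 'w \<Rightarrow> 's)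
       (\<epsilon> :: nat \<Rightarrow> 'w \<Rightarrow> real) (x\<^sub>0 :: 'w \<Rightarrow> real ^ 'n) (l\<^sub>0 :: 'w \<Rightarrow> real ^ 'm)
       (x :: nat \<Rightarrow> nat \<Rightarrow> 'w \<Rightarrow> real ^ 'n) (lam :: nat \<Rightarrow> nat \<Rightarrow> 'w \<Rightarrow> real ^ 'm)
       (N :: nat \<Rightarrow> 'w \<Rightarrow> nat) \<FF> V T_prev
       \<epsilon>\<^sub>G \<kappa>\<^sub>g \<omega>\<^sub>1 \<omega>\<^sub>2 \<kappa>\<^sub>G \<kappa>\<^sub>\<sigma> \<theta> a \<beta> \<gamma>' \<omega>' \<nu> a\<^sub>1 a\<^sub>2.
       expectation_problem \<X> P f gf F gF \<and>
       random_sampling M P x\<^sub>0 l\<^sub>0 n \<xi> \<and>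
       measurable_choices M P x\<^sub>0 l\<^sub>0 n \<xi> solver \<epsilon> lam \<and>
       (\<forall>\<omega>\<in>space M.
          retro_run gF c J solver (\<lambda>k. draws (n k \<omega>) (\<lambda>i. \<xi> k i \<omega>)) \<gamma> (\<lambda>k. \<epsilon> k \<omega>)
            (x\<^sub>0 \<omega>) (l\<^sub>0 \<omega>) (\<lambda>k j. x k j \<omega>) (\<lambda>k j. lam k j \<omega>) (\<lambda>k. N k \<omega>) \<and>
          (\<forall>k. \<exists>j. inner_stop gF c J (\<lambda>k. draws (n k \<omega>) (\<lambda>i. \<xi> k i \<omega>)) \<gamma> (\<lambda>k. \<epsilon> k \<omega>)
                     (\<lambda>k j. x k j \<omega>) (\<lambda>k j. lam k j \<omega>) k j) \<and>
          (\<forall>k. \<forall>j\<le>N k \<omega>. x k j \<omega> \<in> \<X>)) \<and>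
       \<FF> = history M P x\<^sub>0 l\<^sub>0 n \<xi> \<and>
       V = (\<lambda>k. cond_grad_var M (\<FF> k) gf gF (x k 0) (\<xi> k 0)) \<and>
       T_prev = (\<lambda>k \<omega>. norm (kkt_residual gf c J (x k 0 \<omega>)
                  (outer_prev (l\<^sub>0 \<omega>) (\<lambda>k j. lam k j \<omega>) (\<lambda>k. N k \<omega>) k))) \<and>
       0 < \<epsilon>\<^sub>G \<and>
       0 \<le> \<kappa>\<^sub>g \<and> 0 \<le> \<omega>\<^sub>1 \<and> 0 \<le> \<omega>\<^sub>2 \<and>
       (\<forall>k. AE \<omega> in M.
          nn_cond_exp M (\<FF> k) (\<lambda>\<omega>. ennreal ((norm (gf (x k (N k \<omega>) \<omega>)))\<^sup>2)) \<omega> \<le> ennreal (\<kappa>\<^sub>g\<^sup>2)) \<and>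
       (\<forall>y\<in>\<X>. (\<integral>\<^sup>+ \<zeta>. ennreal ((norm (gf y - gF y \<zeta>))\<^sup>2) \<partial>P)
                 \<le> ennreal (\<omega>\<^sub>1\<^sup>2 * (norm (gf y))\<^sup>2 + \<omega>\<^sub>2\<^sup>2)) \<and>
       0 \<le> \<kappa>\<^sub>G \<and> 0 < \<kappa>\<^sub>\<sigma> \<and>
       (\<forall>q\<ge>1. (\<lambda>s. grad_error_ratio \<X> gf gF \<epsilon>\<^sub>G (draws q s)) \<in> borel_measurable (\<Pi>\<^sub>M i\<in>{..<q}. P) \<and>
          (\<integral>\<^sup>+ s. (grad_error_ratio \<X> gf gF \<epsilon>\<^sub>G (draws q s))\<^sup>2 \<partial>(\<Pi>\<^sub>M i\<in>{..<q}. P))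
            \<le> ennreal (\<kappa>\<^sub>G\<^sup>2 / real q)) \<and>
       (\<forall>k. AE \<omega> in M. V k \<omega> \<ge> ennreal (\<kappa>\<^sub>G\<^sup>2 * \<kappa>\<^sub>\<sigma>\<^sup>2)) \<and>
       0 \<le> \<theta> \<and> 0 \<le> a \<and> 0 < \<beta> \<and> \<beta> < 1 \<and>
       (\<forall>k. AE \<omega> in M.
          nn_cond_exp M (\<FF> k) (\<lambda>\<omega>. ennreal ((norm (gf (x k 0 \<omega>)
               - sample_grad gF (draws (n k \<omega>) (\<lambda>i. \<xi> k i \<omega>)) (x k 0 \<omega>)))\<^sup>2)) \<omega>
            \<le> ennreal (\<theta>\<^sup>2 * (T_prev k \<omega>)\<^sup>2 + a\<^sup>2 * \<beta> ^ (2 * k))) \<and>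
       (\<forall>k. 0 \<le> \<gamma> k \<and> \<gamma> k \<le> \<gamma>') \<and> \<gamma>' < 1 \<and>
       0 \<le> \<omega>' \<and>
       (\<forall>k. AE \<omega> in M. \<epsilon> k \<omega> = \<omega>' * sqrt (enn2real (V k \<omega>) / real (n k \<omega>))) \<and>
       a\<^sub>1 = \<gamma>' + \<theta> * (\<omega>' + (\<epsilon>\<^sub>G + \<kappa>\<^sub>g) / \<kappa>\<^sub>\<sigma> + \<gamma>') \<and> a\<^sub>1 < 1 \<and>
       a\<^sub>2 = a * (\<omega>' + (\<epsilon>\<^sub>G + \<kappa>\<^sub>g) / \<kappa>\<^sub>\<sigma> + \<gamma>') \<and>
       0 < \<nu> \<and> a\<^sub>1 + \<nu> < 1
       \<longrightarrow> (\<forall>k. AE \<omega> in M.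
              nn_cond_exp M (\<FF> 0)
                (\<lambda>\<omega>. ennreal (norm (kkt_residual gf c J (x k (N k \<omega>) \<omega>) (lam k (N k \<omega>) \<omega>)))) \<omega>
              \<le> ennreal ((max (a\<^sub>1 + \<nu>) \<beta>) ^ (k + 1)
                   * max (norm (kkt_residual gf c J (x\<^sub>0 \<omega>) (l\<^sub>0 \<omega>))) (a\<^sub>2 / \<nu>))))"
proof (((intro conjI allI impI); (elim conjE)?), goal_cases)
  case (1 D S \<epsilon> x\<^sub>0 l\<^sub>0 x lam N \<kappa>\<^sub>g \<omega>\<^sub>1 \<omega>\<^sub>2 \<theta> \<theta>' a \<beta> \<gamma>' \<omega> \<omega>' \<nu> a\<^sub>1 a\<^sub>2 k)
  have "norm (kkt_residual gf c J (x k (N k)) (lam k (N k)))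
      \<le> max (a\<^sub>1 + \<nu>) \<beta> ^ Suc k * max (norm (kkt_residual gf c J x\<^sub>0 l\<^sub>0)) (a\<^sub>2 / \<nu>)"
    by (rule deterministic_bound[OF problem 1(3) _ _ 1(11-14,20,21,26) _ _ _ _ _ 1(23,25)])
      (use 1(4,5,16,17,18,22) in auto)
  then show ?case
    by simp
next
  case (2 P M n \<xi> \<epsilon> x\<^sub>0 l\<^sub>0 x lam N \<FF> V T_prev
      \<epsilon>\<^sub>G \<kappa>\<^sub>g \<omega>\<^sub>1 \<omega>\<^sub>2 \<kappa>\<^sub>G \<kappa>\<^sub>\<sigma> \<theta> a \<beta> \<gamma>' \<omega>' \<nu> a\<^sub>1 a\<^sub>2 k)
  have "prob_space M" "prob_space P"
    using 2(1,2) by (simp_all add: random_sampling_def expectation_problem_def)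
  with problem 2(1-4) interpret
    retro_expectation M P x\<^sub>0 l\<^sub>0 n \<xi> \<X> f gf c J F gF solver \<gamma> \<epsilon> x lam N
    by (intro retro_expectation.intro retro_expectation_axioms.intro sampling.intro sampling_axioms.intro)
      blast+
  define \<phi> where "\<phi> = (\<epsilon>\<^sub>G + \<kappa>\<^sub>g) / \<kappa>\<^sub>\<sigma>"
  have "0 \<le> \<gamma>'"
    using 2(23) by (meson order_trans)
  have "0 \<le> \<phi>"
    using 2(8,9,15) by (simp add: \<phi>_def)
  \<comment> \<open>The growth bound on the variance supplies the square integrability behind the
    exact formula for the batch error, and ensures that \<open>enn2real\<close> in the tolerance
    loses nothing.\<close>
  have fin: "grad_var y < \<top>" if "y \<in> \<X>" for y
    using 2(13) that by (auto simp: grad_var_def intro: le_less_trans)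
  have "AE \<omega> in M. nn_cond_exp M (hist k) (\<lambda>\<omega>. ennreal (T_end k \<omega>)) \<omega>
      \<le> ennreal (a\<^sub>1 * T_start k \<omega> + a\<^sub>2 * \<beta> ^ k)" for k
    unfolding 2(27,29) \<phi>_def[symmetric]
    by (rule nn_cond_exp_T_end[OF 2(8,9,14,15,18,19,20,25) fin _ _ _ _ _ _ _ _ \<phi>_def])
      (use 2(12,16,17,22,23,26) in \<open>auto simp: 2(5,6,7)\<close>)
  \<comment> \<open>Taken at \<open>Suc k\<close>, since the residual at the end of loop
    \<open>k\<close> is the one at the start of the next loop.\<close>
  then have "AE \<omega> in M. nn_cond_exp M (hist 0) (\<lambda>\<omega>. ennreal (T_start (Suc k) \<omega>)) \<omega>
      \<le> ennreal (max (a\<^sub>1 + \<nu>) \<beta> ^ Suc k * max (T_start 0 \<omega>) (a\<^sub>2 / \<nu>))"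
    using 2(18,19,20,25,30) \<open>0 \<le> \<gamma>'\<close> \<open>0 \<le> \<phi>\<close>
    by (intro nn_cond_exp_initial_T_start) (auto simp: 2(27,29) simp flip: \<phi>_def)
  moreover have "AE \<omega> in M. nn_cond_exp M (hist 0) (\<lambda>\<omega>. ennreal (T_start (Suc k) \<omega>)) \<omega>
      = nn_cond_exp M (hist 0) (\<lambda>\<omega>. ennreal (T_end k \<omega>)) \<omega>"
    by (rule nn_cond_exp_T_start_Suc)
  ultimately show ?case
    unfolding 2(5) using AE_space
  proof eventually_elim
    case (elim \<omega>)
    have "T_start 0 \<omega> = norm (kkt_residual gf c J (x\<^sub>0 \<omega>) (l\<^sub>0 \<omega>))"
      using x_start[OF elim(3), of 0] by (simp add: outer_prev_def)
    then show ?case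
      using elim(1,2) by simp
  qed
qed


end
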